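(* Let $(G,c,H,d)$ be a multicommodity flow coalition game whose supply graph $G$ is a path. Then, for every starting node $r$ and every sequence of admissible choices made by the algorithm INCORPORATE (described in the context), the flow $f$ it returns has payoff vector $\pi(f)$ in the core of the game.
   Context: **Multicommodity flow coalition game $(G,c,H,d)$.** $G=(V,E)$ is a finite undirected graph (supply graph) whose nodes are the players; each node has a capacity $c_v\ge 0$. $H=(V,F)$ is a simple undirected graph on the same node set (commodity graph); each commodity $uv\in F$ has a demand $d_{uv}\ge 0$. $\mathcal P_{uv}$ is the set of simple $u$–$v$ paths in $G$. A feasible flow assigns $f_P\ge 0$ to each $P\in\bigcup_{uv\in F}\mathcal P_{uv}$ with $\sum_{P\ni v} f_P\le c_v$ for all $v\in V$ (a path uses the capacity of all its nodes, including its endpoints) and $f_{uv}:=\sum_{P\in\mathcal P_{uv}}f_P\le d_{uv}$ for all $uv\in F$. For $S\subseteq V$, $\mathcal F^S$ is the set of feasible flows using only paths contained in $G[S]$ (for commodities with both ends in $S$). The payoff of $v$ under $f$ is $\pi_v(f)=\sum_{w:\,wv\in F} f_{wv}$, and $\Pi(S)=\{\pi(f): f\in\mathcal F^S\}$. **Core.** For $\pi\in\Pi(V)$, a nonempty proper subset $S\subsetneq V$ is a breakaway set of $\pi$ if there is $\pi'\in\Pi(S)$ with $\pi'_v>\pi_v$ for all $v\in S$. The core is the set of $\pi\in\Pi(V)$ with no breakaway set. **Algorithm INCORPORATE** (for $G$ a path; $P_{k\ell}$ is the unique $k$–$\ell$ path in $G$). Input: the game and a starting node $r$. Initialize $f=0$,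 $S=\{r\}$, and residual capacities $C_v=c_v$ for all $v$. While $S\ne V$: choose an arbitrary node $v\notin S$ adjacent in $G$ to a node of $S$; replace $S$ by $S\cup\{v\}$ ("$v$ is incorporated"); then go through the previously incorporated nodes $k$ in order of increasing distance from $v$ (closest first, ties broken arbitrarily), and for each $k$ with $kv\in E(H)$ *route* $kv$: set $f_{kv}=\min\{d_{kv},\min_{u\in P_{kv}}C_u\}$ (as flow on $P_{kv}$) and decrease $C_u$ by $f_{kv}$ for all $u\in P_{kv}$. Return $f$. *)

theory Defs
  imports Complex_Main
begin

text \<open>A graph is given by its node set and its set of edges, an edge being a two-element set of nodes.\<close>

definition simple_graph :: "'v set \<Rightarrow> 'v set set \<Rightarrow> bool" where
  "simple_graph V E \<longleftrightarrow> finite V \<and> (\<forall>e\<in>E. e \<subseteq> V \<and> card e = 2)"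

record 'v mcf_game =
  nodes :: "'v set"
  supply_edges :: "'v set set"
  cap :: "'v \<Rightarrow> real"
  commodities :: "'v set set"
  demand :: "'v set \<Rightarrow> real"

definition mcf_game :: "'v mcf_game \<Rightarrow> bool" where
  "mcf_game \<Gamma> \<longleftrightarrow>
     simple_graph (nodes \<Gamma>) (supply_edges \<Gamma>) \<and>
     simple_graph (nodes \<Gamma>) (commodities \<Gamma>) \<and>
     (\<forall>v\<in>nodes \<Gamma>. 0 \<le> cap \<Gamma> v) \<and>
     (\<forall>e\<in>commodities \<Gamma>. 0 \<le> demand \<Gamma> e)"


subsection \<open>Paths\<close>

text \<open>
  A path is the subgraph (node set, edge set) traced by a duplicate-free node list.  It is not the
  list itself: a list and its reversal would be two different objects, whereas a \<open>u\<close>--\<open>v\<close> path in an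
  undirected graph is also a \<open>v\<close>--\<open>u\<close> path.
\<close>

type_synonym 'v path = "'v set \<times> 'v set set"

fun list_edges :: "'v list \<Rightarrow> 'v set set" where
  "list_edges (x # y # zs) = insert {x, y} (list_edges (y # zs))"
| "list_edges _ = {}"

abbreviation path_nodes :: "'v path \<Rightarrow> 'v set" where
  "path_nodes P \<equiv> fst P"

abbreviation path_edges :: "'v path \<Rightarrow> 'v set set" where
  "path_edges P \<equiv> snd P"

definition paths :: "'v mcf_game \<Rightarrow> 'v \<Rightarrow> 'v \<Rightarrow> 'v path set" where
  "paths \<Gamma> u v =
     {(set p, list_edges p) | p.
        p \<noteq> [] \<and> distinct p \<and> hd p = u \<and> last p = v \<and>
        set p \<subseteq> nodes \<Gamma> \<and> list_edges p \<subseteq> supply_edges \<Gamma>}"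

definition supply_is_path :: "'v mcf_game \<Rightarrow> bool" where
  "supply_is_path \<Gamma> \<longleftrightarrow>
     (\<exists>p. p \<noteq> [] \<and> distinct p \<and> nodes \<Gamma> = set p \<and> supply_edges \<Gamma> = list_edges p)"

definition supply_dist :: "'v mcf_game \<Rightarrow> 'v \<Rightarrow> 'v \<Rightarrow> nat" where
  "supply_dist \<Gamma> u v = (LEAST n. \<exists>P\<in>paths \<Gamma> u v. card (path_edges P) = n)"


subsection \<open>Flows, payoffs and the core\<close>

definition commodity_paths :: "'v mcf_game \<Rightarrow> 'v path set" where
  "commodity_paths \<Gamma> = (\<Union>(u, v) \<in> {(u, v). {u, v} \<in> commodities \<Gamma>}. paths \<Gamma> u v)"

definition commodity_flow :: "'v mcf_game \<Rightarrow> ('v path \<Rightarrow> real) \<Rightarrow> 'v \<Rightarrow> 'v \<Rightarrow> real" where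
  "commodity_flow \<Gamma> f u v = (\<Sum>P\<in>paths \<Gamma> u v. f P)"

text \<open>A flow is a total function on paths, fixed to be zero outside \<^const>\<open>commodity_paths\<close>.\<close>

definition feasible :: "'v mcf_game \<Rightarrow> ('v path \<Rightarrow> real) \<Rightarrow> bool" where
  "feasible \<Gamma> f \<longleftrightarrow>
     (\<forall>P\<in>commodity_paths \<Gamma>. 0 \<le> f P) \<and>
     (\<forall>P. P \<notin> commodity_paths \<Gamma> \<longrightarrow> f P = 0) \<and>
     (\<forall>v\<in>nodes \<Gamma>. (\<Sum>P | P \<in> commodity_paths \<Gamma> \<and> v \<in> path_nodes P. f P) \<le> cap \<Gamma> v) \<and>
     (\<forall>u v. {u, v} \<in> commodities \<Gamma> \<longrightarrow> commodity_flow \<Gamma> f u v \<le> demand \<Gamma> {u, v})"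

text \<open>
  A path of the supply graph lies in the subgraph induced by \<open>S\<close> iff all its nodes are in \<open>S\<close>;
  in particular the ends of its commodity are then in \<open>S\<close>.
\<close>

definition flows_within :: "'v mcf_game \<Rightarrow> 'v set \<Rightarrow> ('v path \<Rightarrow> real) set" where
  "flows_within \<Gamma> S = {f. feasible \<Gamma> f \<and> (\<forall>P. f P \<noteq> 0 \<longrightarrow> path_nodes P \<subseteq> S)}"

definition payoff :: "'v mcf_game \<Rightarrow> ('v path \<Rightarrow> real) \<Rightarrow> 'v \<Rightarrow> real" where
  "payoff \<Gamma> f v = (\<Sum>w | {w, v} \<in> commodities \<Gamma>. commodity_flow \<Gamma> f w v)"

definition payoffs :: "'v mcf_game \<Rightarrow> 'v set \<Rightarrow> ('v \<Rightarrow> real) set" where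
  "payoffs \<Gamma> S = payoff \<Gamma> ` flows_within \<Gamma> S"

definition breakaway :: "'v mcf_game \<Rightarrow> ('v \<Rightarrow> real) \<Rightarrow> 'v set \<Rightarrow> bool" where
  "breakaway \<Gamma> \<pi> S \<longleftrightarrow>
     S \<noteq> {} \<and> S \<subset> nodes \<Gamma> \<and> (\<exists>\<pi>'\<in>payoffs \<Gamma> S. \<forall>v\<in>S. \<pi>' v > \<pi> v)"

definition core :: "'v mcf_game \<Rightarrow> ('v \<Rightarrow> real) set" where
  "core \<Gamma> = {\<pi> \<in> payoffs \<Gamma> (nodes \<Gamma>). \<nexists>S. breakaway \<Gamma> \<pi> S}"


subsection \<open>Algorithm INCORPORATE\<close>

text \<open>Meaningful only when there is exactly one path between the two nodes.\<close>

definition the_path :: "'v mcf_game \<Rightarrow> 'v \<Rightarrow> 'v \<Rightarrow> 'v path" where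
  "the_path \<Gamma> k l = (THE P. P \<in> paths \<Gamma> k l)"

text \<open>The second component of the state holds the residual capacities.\<close>

definition route ::
  "'v mcf_game \<Rightarrow> 'v \<Rightarrow> 'v \<Rightarrow> ('v path \<Rightarrow> real) \<times> ('v \<Rightarrow> real) \<Rightarrow> ('v path \<Rightarrow> real) \<times> ('v \<Rightarrow> real)"
where
  "route \<Gamma> v k = (\<lambda>(f, C).
     if {k, v} \<in> commodities \<Gamma> then
       let P = the_path \<Gamma> k v;
           x = min (demand \<Gamma> {k, v}) (Min (C ` path_nodes P))
       in (f(P := x), \<lambda>u. if u \<in> path_nodes P then C u - x else C u)
     else (f, C))"

text \<open>
  \<open>incorporate_reaches \<Gamma> r S f C\<close>: some sequence of admissible choices leads from the
  initialisation at \<open>r\<close> to the loop head with variables \<open>S\<close>, \<open>f\<close>, \<open>C\<close>.  The list \<open>ks\<close> is the order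
  in which the previously incorporated nodes are processed.
\<close>

inductive incorporate_reaches ::
  "'v mcf_game \<Rightarrow> 'v \<Rightarrow> 'v set \<Rightarrow> ('v path \<Rightarrow> real) \<Rightarrow> ('v \<Rightarrow> real) \<Rightarrow> bool"
  for \<Gamma> :: "'v mcf_game" and r :: 'v
where
  init: "incorporate_reaches \<Gamma> r {r} (\<lambda>_. 0) (cap \<Gamma>)"
| step: "incorporate_reaches \<Gamma> r (insert v S) f' C'"
    if "incorporate_reaches \<Gamma> r S f C"
      and "v \<in> nodes \<Gamma>" and "v \<notin> S" and "\<exists>u\<in>S. {u, v} \<in> supply_edges \<Gamma>"
      and "distinct ks" and "set ks = S"
      and "sorted_wrt (\<lambda>k l. supply_dist \<Gamma> v k \<le> supply_dist \<Gamma> v l) ks"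
      and "fold (route \<Gamma> v) ks (f, C) = (f', C')"

definition incorporate_returns :: "'v mcf_game \<Rightarrow> 'v \<Rightarrow> ('v path \<Rightarrow> real) \<Rightarrow> bool" where
  "incorporate_returns \<Gamma> r f \<longleftrightarrow> (\<exists>C. incorporate_reaches \<Gamma> r (nodes \<Gamma>) f C)"

end

theory Submission
  imports Defs
begin

text \<open>
  Call a commodity blocked if its demand is not met, and call a node of its path a blocker if its
  capacity was exhausted when the commodity had been routed.  Suppose that a deviation gains for
  all nodes of a segment \<open>I\<close>, a component of the breakaway set.  Let \<open>u\<close> be the rightmost blocker of
  a commodity with both ends in \<open>I\<close>, and among the commodities in \<open>I\<close> blocked by \<open>u\<close> take the first
  one routed, with later end \<open>l\<close>.  Commodities in \<open>I\<close> to the right of \<open>u\<close> are all satisfied, and every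
  flow through \<open>u\<close> up to that moment has an end in the set \<open>W\<close> of the nodes from \<open>u\<close> rightwards
  incorporated by then.  Summing payoffs over \<open>W\<close> bounds the deviation by the capacity of \<open>u\<close> plus
  satisfied demands, so \<open>W\<close> cannot gain as a whole if \<open>W\<close> lies in \<open>I\<close>.  Hence some node to the right
  of \<open>I\<close> was incorporated before \<open>l\<close>, a node of \<open>I\<close>.  By reflection the same holds on the left.
  Since the incorporated nodes always form a segment, all of \<open>I\<close> was incorporated before the later
  of the two nodes \<open>l\<close>, a contradiction.
\<close>

subsection \<open>Deviations on a line\<close>

definition between :: "('v \<Rightarrow> int) \<Rightarrow> 'v \<Rightarrow> 'v \<Rightarrow> 'v \<Rightarrow> bool" where
  "between pos x u y \<longleftrightarrow> min (pos x) (pos y) \<le> pos u \<and> pos u \<le> max (pos x) (pos y)"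

text \<open>For symmetric \<open>h\<close> and injective \<open>pos\<close>, each unordered pair
  whose segment contains \<open>u\<close> is counted exactly once, with its upper end first. Pairs
  ending at \<open>u\<close> count as well, since a path uses the capacity of its endpoints.\<close>

definition load :: "'v set \<Rightarrow> ('v \<Rightarrow> int) \<Rightarrow> ('v \<Rightarrow> 'v \<Rightarrow> real) \<Rightarrow> 'v \<Rightarrow> real" where
  "load N pos h u = (\<Sum>y | y \<in> N \<and> pos u \<le> pos y. \<Sum>x | x \<in> N \<and> pos x \<le> pos u. h y x)"

text \<open>
  \<open>T\<close> is the time of incorporation.  A pair is routed when its later end is incorporated, and
  shorter pairs come first; so \<open>later pos T x' y' x y\<close> says that \<open>x'y'\<close> is routed after \<open>xy\<close>.
\<close>

definition later :: "('v \<Rightarrow> int) \<Rightarrow> ('v \<Rightarrow> nat) \<Rightarrow> 'v \<Rightarrow> 'v \<Rightarrow> 'v \<Rightarrow> 'v \<Rightarrow> bool" where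
  "later pos T x' y' x y \<longleftrightarrow>
     max (T x) (T y) < max (T x') (T y') \<or>
     max (T x) (T y) = max (T x') (T y') \<and> \<bar>pos x - pos y\<bar> < \<bar>pos x' - pos y'\<bar>"

text \<open>
  A node with exhausted capacity at the moment \<open>xy\<close> is routed stays so; its final load then
  equals its capacity, and no flow through it is routed afterwards.
\<close>

definition blocker ::
  "'v set \<Rightarrow> ('v \<Rightarrow> int) \<Rightarrow> ('v \<Rightarrow> nat) \<Rightarrow> ('v \<Rightarrow> real) \<Rightarrow> ('v \<Rightarrow> 'v \<Rightarrow> real) \<Rightarrow> 'v \<Rightarrow> 'v \<Rightarrow> 'v \<Rightarrow> bool"
where
  "blocker N pos T c g x y u \<longleftrightarrow>
     u \<in> N \<and> between pos x u y \<and> load N pos g u = c u \<and>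
     (\<forall>x'\<in>N. \<forall>y'\<in>N. between pos x' u y' \<and> later pos T x' y' x y \<longrightarrow> g x' y' = 0)"

section \<open>Symmetry under exchanging ends and reflecting the line\<close>

lemma between_uminus [simp]: "between (\<lambda>v. - pos v) = between pos"
  by (auto simp: between_def fun_eq_iff)

lemma between_commute: "between pos x u y = between pos y u x"
  by (auto simp: between_def)

lemma later_uminus [simp]: "later (\<lambda>v. - pos v) = later pos"
  by (auto simp: later_def fun_eq_iff abs_minus_commute)

lemma later_commute: "later pos T x' y' x y = later pos T x' y' y x"
  by (auto simp: later_def max.commute abs_minus_commute)

text \<open>Reflection swaps upper and lower ends of the pairs; exchanging the sums and then, by
  symmetry, the arguments of \<open>h\<close> restores the original expression.\<close>

lemma load_uminus:
  assumes "\<And>x y. h x y = h y x"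
  shows "load N (\<lambda>v. - pos v) h = load N pos h"
proof
  fix u
  have "load N (\<lambda>v. - pos v) h u =
      (\<Sum>y | y \<in> N \<and> pos y \<le> pos u. \<Sum>x | x \<in> N \<and> pos u \<le> pos x. h y x)"
    by (simp add: load_def)
  also have "\<dots> = (\<Sum>x | x \<in> N \<and> pos u \<le> pos x. \<Sum>y | y \<in> N \<and> pos y \<le> pos u. h y x)"
    by (rule sum.swap)
  also have "\<dots> = load N pos h u"
    unfolding load_def by (intro sum.cong refl) (rule assms)
  finally show "load N (\<lambda>v. - pos v) h u = load N pos h u" .
qed

lemma blocker_commute: "blocker N pos T c g x y = blocker N pos T c g y x"
  by (simp add: blocker_def fun_eq_iff between_commute[of pos x] later_commute[of pos T _ _ x])

lemma blocker_uminus: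
  assumes "\<And>x y. g x y = g y x"
  shows "blocker N (\<lambda>v. - pos v) T c g = blocker N pos T c g"
  unfolding blocker_def fun_eq_iff by (simp add: load_uminus[OF assms])

text \<open>
  A pair of nodes through \<open>u\<close> is charged to one of its ends in \<open>W\<close>, so that the first two sums are
  the part of the load of \<open>u\<close> contributed by pairs touching \<open>W\<close>.
\<close>

lemma sum_payoff_split:
  fixes h :: "'v \<Rightarrow> 'v \<Rightarrow> real" and pos :: "'v \<Rightarrow> int"
  assumes "finite N" "W \<subseteq> N" "u \<in> W" "\<And>w. w \<in> W \<Longrightarrow> pos u \<le> pos w" "inj_on pos N"
  shows "(\<Sum>v\<in>W. \<Sum>y\<in>N. h v y) =
    (\<Sum>v\<in>W. \<Sum>y | y \<in> N \<and> pos y \<le> pos u. h v y)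
    + (\<Sum>y | y \<in> N - W \<and> pos u < pos y. h u y)
    + (\<Sum>y\<in>W - {u}. h u y)
    + (\<Sum>v\<in>W - {u}. \<Sum>y | y \<in> N \<and> pos u < pos y. h v y)"
proof -
  let ?R = "{y \<in> N. pos u < pos y}"
  have fW: "finite W" using assms finite_subset by blast
  have N: "N = {y \<in> N. pos y \<le> pos u} \<union> ?R" by auto
  have split: "(\<Sum>y\<in>N. h v y) = (\<Sum>y | y \<in> N \<and> pos y \<le> pos u. h v y) + (\<Sum>y\<in>?R. h v y)" for v
    by (subst N, rule sum.union_disjoint) (use assms(1) in auto)
  have strict: "pos u < pos w" if "w \<in> W" "w \<noteq> u" for w
    using inj_onD[OF assms(5), of u w] assms(2,3) assms(4)[of w] that by force
  have R: "?R = {y \<in> N - W. pos u < pos y} \<union> (W - {u})"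
    using assms strict by auto
  have "(\<Sum>y\<in>?R. h u y) = (\<Sum>y | y \<in> N - W \<and> pos u < pos y. h u y) + (\<Sum>y\<in>W - {u}. h u y)"
    unfolding R by (rule sum.union_disjoint) (use assms fW in auto)
  moreover have "(\<Sum>v\<in>W. \<Sum>y\<in>?R. h v y) = (\<Sum>y\<in>?R. h u y) + (\<Sum>v\<in>W - {u}. \<Sum>y\<in>?R. h v y)"
    by (rule sum.remove[OF fW \<open>u \<in> W\<close>])
  ultimately show ?thesis unfolding split sum.distrib by linarith
qed

text \<open>The upper end of a pair through \<open>u\<close> is in \<open>W\<close> or strictly to
  the right of \<open>u\<close>: by injectivity only \<open>u\<close> itself, a member of
  \<open>W\<close>, has the position of \<open>u\<close>.\<close>

lemma load_split:
  assumes "finite N" "W \<subseteq> N" "u \<in> W" "\<And>w. w \<in> W \<Longrightarrow> pos u \<le> pos w" "inj_on pos N"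
  shows "load N pos h u =
    (\<Sum>v\<in>W. \<Sum>y | y \<in> N \<and> pos y \<le> pos u. h v y)
    + (\<Sum>v | v \<in> N - W \<and> pos u < pos v. \<Sum>y | y \<in> N \<and> pos y \<le> pos u. h v y)"
proof -
  have fW: "finite W" using assms finite_subset by blast
  have "pos u < pos w" if "w \<in> N" "pos u \<le> pos w" "w \<noteq> u" for w
    using inj_onD[OF assms(5), of u w] assms(2,3) that by force
  then have "{y. y \<in> N \<and> pos u \<le> pos y} = W \<union> {y \<in> N - W. pos u < pos y}"
    using assms(2-4) by (auto intro: less_imp_le)
  then show ?thesis
    unfolding load_def by (simp only:, intro sum.union_disjoint) (use assms(1) fW in auto)
qed

text \<open>A contradictory situation, refuted in \<open>no_deviation\<close>. Here \<open>g\<close>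
  stands for the flow of the algorithm, \<open>g'\<close> for a deviating flow cut down to one
  component \<open>I\<close> of a breakaway set, \<open>d\<close> and \<open>c\<close> for demands
  and capacities. \<open>T_convex\<close> expresses that the nodes incorporated up to any time form
  a segment.\<close>

locale line_deviation =
  fixes N I :: "'v set" and pos :: "'v \<Rightarrow> int" and T :: "'v \<Rightarrow> nat"
    and g g' d :: "'v \<Rightarrow> 'v \<Rightarrow> real" and c :: "'v \<Rightarrow> real"
  assumes finite_N: "finite N"
    and inj_pos: "inj_on pos N"
    and inj_T: "inj_on T N"
    and T_convex: "\<lbrakk>x \<in> N; y \<in> N; z \<in> N; pos x \<le> pos y; pos y \<le> pos z\<rbrakk> \<Longrightarrow> T y \<le> max (T x) (T z)"
    and g_commute: "g x y = g y x"
    and d_commute: "d x y = d y x"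
    and g_nonneg: "0 \<le> g x y"
    and g'_commute: "g' x y = g' y x"
    and g'_nonneg: "0 \<le> g' x y"
    and g'_le: "g' x y \<le> d x y"
    and g'_load: "u \<in> N \<Longrightarrow> load N pos g' u \<le> c u"
    and g'_outside: "x \<notin> I \<Longrightarrow> g' x y = 0"
    and I_subset: "I \<subseteq> N"
    and I_nonempty: "I \<noteq> {}"
    and I_convex: "\<lbrakk>x \<in> I; z \<in> I; y \<in> N; pos x \<le> pos y; pos y \<le> pos z\<rbrakk> \<Longrightarrow> y \<in> I"
    and blocked: "\<lbrakk>x \<in> N; y \<in> N; g x y < d x y\<rbrakk> \<Longrightarrow> \<exists>u. blocker N pos T c g x y u"
    and gain: "v \<in> I \<Longrightarrow> (\<Sum>y\<in>N. g v y) < (\<Sum>y\<in>N. g' v y)"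
begin

text \<open>No assumption prefers a direction of the line, so whatever is shown about the right side
  of \<open>I\<close> can be reused for its left side.\<close>

lemma reflected: "line_deviation N I (\<lambda>v. - pos v) T g g' d c"
proof unfold_locales
  show "inj_on (\<lambda>v. - pos v) N" using inj_pos by (auto simp: inj_on_def)
  show "T y \<le> max (T x) (T z)"
    if "x \<in> N" "y \<in> N" "z \<in> N" "- pos x \<le> - pos y" "- pos y \<le> - pos z" for x y z
    using T_convex[of z y x] that by (simp add: max.commute)
  show "load N (\<lambda>v. - pos v) g' u \<le> c u" if "u \<in> N" for u
    using g'_load[OF that] load_uminus[of g', OF g'_commute] by simp
  show "y \<in> I" if "x \<in> I" "z \<in> I" "y \<in> N" "- pos x \<le> - pos y" "- pos y \<le> - pos z" for x y z
    using I_convex[of z x y] that by simp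
  show "\<exists>u. blocker N (\<lambda>v. - pos v) T c g x y u"
    if "x \<in> N" "y \<in> N" "g x y < d x y" for x y
    using blocked[OF that] blocker_uminus[of g, OF g_commute] by simp
qed (fact finite_N inj_T g_commute d_commute g_nonneg g'_commute g'_nonneg g'_le g'_outside
      I_subset I_nonempty gain)+

text \<open>The counting argument. By \<open>zero\<close>, all flow of \<open>g\<close> through the
  saturated node \<open>u\<close> belongs to pairs with an end in \<open>W\<close>, so
  \<open>W\<close> already collects the full capacity of \<open>u\<close>. The remaining parts of
  its payoff are the pairs strictly to the right of \<open>u\<close> and those joining
  \<open>u\<close> to \<open>W\<close>, where \<open>le\<close> and \<open>le_u\<close> leave no
  room for improvement. So the total payoff of \<open>W\<close> cannot rise, against
  \<open>gain\<close>.\<close>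

lemma no_gain_set:
  assumes "W \<subseteq> I" "u \<in> W" "\<And>w. w \<in> W \<Longrightarrow> pos u \<le> pos w" "load N pos g u = c u"
    and zero: "\<And>x y. \<lbrakk>x \<in> N; y \<in> N; pos x \<le> pos u; pos u < pos y; y \<notin> W; x \<noteq> u\<rbrakk> \<Longrightarrow> g y x = 0"
    and le: "\<And>v y. \<lbrakk>v \<in> W - {u}; y \<in> N; pos u < pos y\<rbrakk> \<Longrightarrow> g' v y \<le> g v y"
    and le_u: "\<And>y. y \<in> W - {u} \<Longrightarrow> g' u y \<le> g u y"
  shows False
proof -
  have WN: "W \<subseteq> N" using assms I_subset by blast
  have u: "u \<in> N" using WN assms by blast
  have fW: "finite W" using WN finite_N finite_subset by blast
  let ?L = "{y. y \<in> N \<and> pos y \<le> pos u}"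
  let ?R = "{v. v \<in> N - W \<and> pos u < pos v}"
  have fL: "finite ?L" and uL: "u \<in> ?L" using finite_N u by auto
  have A: "(\<Sum>y\<in>?R. g' u y) \<le> (\<Sum>v\<in>?R. \<Sum>y\<in>?L. g' v y)"
  proof (rule sum_mono)
    fix v
    show "g' u v \<le> (\<Sum>y\<in>?L. g' v y)"
      by (subst sum.remove[OF fL uL]) (simp add: g'_commute[of u v] sum_nonneg g'_nonneg)
  qed
  have B: "(\<Sum>v\<in>?R. \<Sum>y\<in>?L. g v y) = (\<Sum>y\<in>?R. g u y)"
  proof (rule sum.cong[OF refl])
    fix v assume v: "v \<in> ?R"
    have "(\<Sum>y\<in>?L - {u}. g v y) = 0"
      by (rule sum.neutral) (use v zero in auto)
    then show "(\<Sum>y\<in>?L. g v y) = g u v"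
      by (subst sum.remove[OF fL uL]) (simp add: g_commute[of u v])
  qed
  note split = sum_payoff_split[OF finite_N WN assms(2,3) inj_pos]
  note lsplit = load_split[OF finite_N WN assms(2,3) inj_pos]
  \<comment> \<open>For \<open>g\<close> the right-hand side equals the load \<open>c u\<close>, by
    \<open>B\<close>; for \<open>g'\<close> the left-hand side is at most its load, by
    \<open>A\<close>, and thus at most \<open>c u\<close>.\<close>
  have C: "(\<Sum>v\<in>W. \<Sum>y\<in>?L. g' v y) + (\<Sum>y\<in>?R. g' u y) \<le> (\<Sum>v\<in>W. \<Sum>y\<in>?L. g v y) + (\<Sum>y\<in>?R. g u y)"
    using A B g'_load[OF u] lsplit[of g] lsplit[of g'] assms(4) by linarith
  have "(\<Sum>y\<in>W - {u}. g' u y) \<le> (\<Sum>y\<in>W - {u}. g u y)"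
    by (rule sum_mono) (rule le_u)
  moreover have "(\<Sum>v\<in>W - {u}. \<Sum>y | y \<in> N \<and> pos u < pos y. g' v y)
      \<le> (\<Sum>v\<in>W - {u}. \<Sum>y | y \<in> N \<and> pos u < pos y. g v y)"
    by (intro sum_mono le) auto
  ultimately have "(\<Sum>v\<in>W. \<Sum>y\<in>N. g' v y) \<le> (\<Sum>v\<in>W. \<Sum>y\<in>N. g v y)"
    using C split[of g] split[of g'] by linarith
  moreover have "(\<Sum>v\<in>W. \<Sum>y\<in>N. g v y) < (\<Sum>v\<in>W. \<Sum>y\<in>N. g' v y)"
    by (rule sum_strict_mono) (use fW assms gain in auto)
  ultimately show False by linarith
qed

section \<open>The rightmost blocker and the nodes to its right\<close>

definition blocks :: "'v \<Rightarrow> 'v \<Rightarrow> 'v \<Rightarrow> bool" where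
  "blocks x y u \<longleftrightarrow> x \<in> I \<and> y \<in> I \<and> g x y < d x y \<and> blocker N pos T c g x y u"

lemma blocks_commute: "blocks x y u \<Longrightarrow> blocks y x u"
  by (simp add: blocks_def g_commute[of x] d_commute[of x] blocker_commute[of _ _ _ _ _ x])

text \<open>A blocker lies between the two ends, so convexity puts it in \<open>I\<close> with
  them.\<close>

lemma blocks_ex:
  assumes "x \<in> I" "y \<in> I" "g x y < d x y"
  shows "\<exists>u\<in>I. blocks x y u"
proof -
  obtain u where u: "blocker N pos T c g x y u"
    using blocked assms I_subset by blast
  then have "u \<in> I"
    using I_convex[of x y u] I_convex[of y x u] assms(1,2)
    by (auto simp: blocker_def between_def min_def max_def split: if_splits)
  with u assms show ?thesis by (auto simp: blocks_def)
qed

text \<open>A gaining node has some pair on which \<open>g'\<close> exceeds \<open>g\<close>. The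
  flow \<open>g'\<close> is positive there, so the other end is in \<open>I\<close>; and
  \<open>g'\<close> respects the demand, so \<open>g\<close> does not meet it.\<close>

lemma some_blocks: "\<exists>u\<in>I. \<exists>x y. blocks x y u"
proof -
  obtain v where v: "v \<in> I" using I_nonempty by blast
  have "\<not> (\<forall>y\<in>N. g' v y \<le> g v y)"
    using gain[OF v] sum_mono[of N "g' v" "g v"] by fastforce
  then obtain y where y: "g v y < g' v y" by (auto simp: not_le)
  then have "y \<in> I"
    using g'_outside[of y v] g'_commute[of v y] g_nonneg[of v y] by (cases "y \<in> I") auto
  then show ?thesis
    using blocks_ex[OF v] y g'_le[of v y] by fastforce
qed

text \<open>The pair \<open>xy\<close> is the first one blocked by the rightmost blocker,
  \<open>max (T x) (T y)\<close> is the time of its routing, and \<open>w\<close> is a node of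
  \<open>W\<close> outside \<open>I\<close>, which exists because \<open>W\<close> would otherwise
  contradict \<open>no_gain_set\<close>.\<close>

lemma early_node_on_right:
  "\<exists>x\<in>I. \<exists>y\<in>I. \<exists>w\<in>N. (\<forall>z\<in>I. pos z < pos w) \<and> T w < max (T x) (T y)"
proof -
  define U where "U = {u \<in> I. \<exists>x y. blocks x y u}"
  have fU: "finite U" using I_subset finite_N finite_subset unfolding U_def by fastforce
  have "U \<noteq> {}" using some_blocks by (auto simp: U_def)
  then have "Max (pos ` U) \<in> pos ` U" using fU by (intro Max_in) auto
  then obtain u where u: "u \<in> U" and "pos u = Max (pos ` U)" by force
  then have u_max: "pos u' \<le> pos u" if "u' \<in> U" for u'
    using fU that by simp
  have uI: "u \<in> I" and uN: "u \<in> N" using u I_subset by (auto simp: U_def)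

  \<comment> \<open>An unmet pair of \<open>I\<close> strictly to the right of \<open>u\<close>
    would have its own blocker there, against the choice of \<open>u\<close>. A pair with an end
    outside \<open>I\<close> carries nothing under \<open>g'\<close>.\<close>
  have right: "g' x y \<le> g x y" if "x \<in> N" "y \<in> N" "pos u < pos x" "pos u < pos y" for x y
  proof (cases "x \<in> I \<and> y \<in> I \<and> g x y < d x y")
    case True
    then obtain u' where u': "u' \<in> I" "blocks x y u'" using blocks_ex by blast
    then have "u' \<in> U" by (auto simp: U_def)
    moreover have "pos u < pos u'"
      using u' that by (auto simp: blocks_def blocker_def between_def)
    ultimately show ?thesis using u_max by fastforce
  next
    case False
    then show ?thesis
      using g'_outside[of x y] g'_outside[of y x] g'_commute[of x y] g_nonneg[of x y] g'_le[of x y]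
      by (cases "x \<in> I"; cases "y \<in> I") auto
  qed

  define B where "B = {(x, y). blocks x y u}"
  \<comment> \<open>The routing order as a lexicographic measure, time first and length second, so
    that well-foundedness provides a first blocked pair.\<close>
  define \<rho> where "\<rho> = measures [\<lambda>(x, y). max (T x) (T y), \<lambda>(x, y). nat \<bar>pos x - pos y\<bar>]"
  have \<rho>: "((x, y), (x', y')) \<in> \<rho> \<longleftrightarrow> later pos T x' y' x y" for x y x' y'
    by (auto simp: \<rho>_def later_def)
  have "B \<noteq> {}" using u by (auto simp: U_def B_def)
  moreover have "wf \<rho>" by (simp add: \<rho>_def)
  ultimately obtain e where e: "e \<in> B" "\<And>e'. (e', e) \<in> \<rho> \<Longrightarrow> e' \<notin> B"
    by (metis all_not_in_conv wfE_min)
  obtain x0 y0 where xy0: "e = (x0, y0)" by fastforce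
  have xy0: "blocks x0 y0 u" "\<And>x' y'. blocks x' y' u \<Longrightarrow> \<not> later pos T x0 y0 x' y'"
    using e \<rho> unfolding xy0 B_def by auto
  \<comment> \<open>Without loss of generality \<open>x\<close> is the left end, as blocking and the
    routing order do not depend on the order of the ends.\<close>
  obtain x y where xy: "blocks x y u" "pos x \<le> pos y"
    and not_later: "\<And>x' y'. blocks x' y' u \<Longrightarrow> \<not> later pos T x y x' y'"
  proof (cases "pos x0 \<le> pos y0")
    case True
    then show thesis using xy0 that[of x0 y0] by blast
  next
    case False
    moreover have "later pos T y0 x0 = later pos T x0 y0"
      by (simp add: later_def fun_eq_iff max.commute[of "T y0"] abs_minus_commute[of "pos y0"])
    ultimately show thesis
      by (intro that[OF blocks_commute[OF xy0(1)]]) (simp_all add: xy0(2))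
  qed
  have xI: "x \<in> I" and yI: "y \<in> I" and bl: "blocker N pos T c g x y u"
    using xy by (auto simp: blocks_def)
  have xN: "x \<in> N" and yN: "y \<in> N" using xI yI I_subset by auto
  have pos_xu: "pos x \<le> pos u" and pos_uy: "pos u \<le> pos y" and ld: "load N pos g u = c u"
    using bl xy by (auto simp: blocker_def between_def)
  have zero: "g x' y' = 0"
    if "x' \<in> N" "y' \<in> N" "pos x' \<le> pos u" "pos u \<le> pos y'" "later pos T x' y' x y" for x' y'
    using bl that by (auto simp: blocker_def between_def)

  define t where "t = max (T x) (T y)"
  have late_end: "z = x \<or> z = y" if "z \<in> N" "T z = t" for z
    using that inj_T xN yN by (auto simp: t_def max_def inj_on_def split: if_splits)
  have T_u: "T u \<le> t"
    using T_convex[OF xN uN yN] pos_xu pos_uy by (simp add: t_def)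
  \<comment> \<open>If \<open>u\<close> were the later end of \<open>xy\<close>, then
    \<open>{u}\<close> alone would refute the gain: any pair with ends on both sides of
    \<open>u\<close> has, by \<open>T_convex\<close>, an end incorporated after \<open>u\<close>, so
    it is routed after \<open>xy\<close> and carries no flow.\<close>
  have "T u \<noteq> t"
  proof
    assume t: "T u = t"
    show False
    proof (rule no_gain_set[of "{u}" u])
      show "g y' x' = 0"
        if "x' \<in> N" "y' \<in> N" "pos x' \<le> pos u" "pos u < pos y'" "y' \<notin> {u}" "x' \<noteq> u" for x' y'
      proof -
        have "T u \<noteq> T x'" "T u \<noteq> T y'" using inj_T that uN by (auto simp: inj_on_def)
        moreover have "T u \<le> max (T x') (T y')"
          using T_convex[of x' u y'] that uN by auto
        ultimately have "later pos T x' y' x y"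
          using t by (auto simp: later_def t_def)
        then show ?thesis using zero[of x' y'] that g_commute by force
      qed
    qed (use uI ld in auto)
  qed
  then have T_u: "T u < t" using T_u by simp

  txt \<open>
    Every pair through \<open>u\<close> routed no later than \<open>xy\<close> has an end in \<open>W\<close>.  If \<open>u\<close> is itself an end of
    \<open>xy\<close>, the other end must be left out, as the demand of \<open>xy\<close> is not met.
  \<close>
  define W where "W = {w \<in> N. pos u \<le> pos w \<and> (T w < t \<or> T w = t \<and> u \<noteq> x \<and> u \<noteq> y)}"
  have "\<not> W \<subseteq> I"
  proof
    assume WI: "W \<subseteq> I"
    show False
    proof (rule no_gain_set[of W u])
      show "W \<subseteq> I" by fact
      show "u \<in> W" using uN T_u by (simp add: W_def)
      show "pos u \<le> pos w" if "w \<in> W" for w using that by (simp add: W_def)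
      show "load N pos g u = c u" by fact
      show "g y' x' = 0"
        if "x' \<in> N" "y' \<in> N" "pos x' \<le> pos u" "pos u < pos y'" "y' \<notin> W" "x' \<noteq> u" for x' y'
      proof -
        \<comment> \<open>Either \<open>y'\<close> is incorporated after \<open>t\<close>, or
          \<open>T y' = t\<close> and the definition of \<open>W\<close> leaves only
          \<open>y' = y\<close> with \<open>u = x\<close>. Then \<open>x'\<close> lies to the left
          of \<open>x\<close>, so even if routed in the same round the pair \<open>x'y'\<close> is
          longer than \<open>xy\<close>.\<close>
        have "later pos T x' y' x y"
        proof (cases "T y' = t")
          case True
          then have *: "u = x \<or> u = y" using that by (auto simp: W_def)
          have "y' = x \<or> y' = y" using late_end[OF that(2) True] .
          then have "y' = y" using pos_xu that by auto
          then have "u = x" using * that by auto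
          then have "pos x' < pos x" using that uN inj_pos by (auto simp: inj_on_def order_less_le)
          then show ?thesis using True \<open>y' = y\<close> xy(2)
            by (auto simp: later_def t_def max_def split: if_splits)
        next
          case False
          then have "t < T y'" using that by (auto simp: W_def)
          then show ?thesis by (auto simp: later_def t_def)
        qed
        then show ?thesis using zero[of x' y'] that g_commute[of x' y'] by simp
      qed
      show "g' v y' \<le> g v y'" if "v \<in> W - {u}" "y' \<in> N" "pos u < pos y'" for v y'
      proof -
        have "pos u \<noteq> pos v" using that uN inj_pos by (auto simp: W_def inj_on_def)
        then show ?thesis using that by (intro right) (auto simp: W_def)
      qed
      \<comment> \<open>Otherwise the pair \<open>u y'\<close> is unmet, and since \<open>u\<close>
        is the rightmost blocker, \<open>u\<close> itself blocks it. Being first, \<open>xy\<close>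
        is not routed after it, which forces \<open>T y' = t\<close>. Then \<open>u\<close> is no
        end of \<open>xy\<close> and \<open>y' = y\<close>, so \<open>u y'\<close> is a shorter pair
        of the same round, a contradiction.\<close>
      show "g' u y' \<le> g u y'" if y': "y' \<in> W - {u}" for y'
      proof (rule ccontr)
        assume "\<not> ?thesis"
        then have "g u y' < d u y'" using g'_le[of u y'] by linarith
        then obtain u' where u': "u' \<in> I" "blocks u y' u'" using blocks_ex uI y' WI by blast
        have y'N: "y' \<in> N" and less: "pos u < pos y'"
          using y' uN inj_pos by (auto simp: W_def inj_on_def order_less_le)
        have "u' \<in> U" using u' by (auto simp: U_def)
        then have "pos u' \<le> pos u" by (rule u_max)
        moreover have "pos u \<le> pos u'" using u' less by (auto simp: blocks_def blocker_def between_def)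
        ultimately have "u' = u" using inj_pos u'(1) uN I_subset by (auto simp: inj_on_def)
        then have nl: "\<not> later pos T x y u y'" using not_later u' by blast
        have "T y' = t"
        proof (rule ccontr)
          assume "T y' \<noteq> t"
          then have "max (T u) (T y') < t" using T_u y' by (auto simp: W_def)
          then show False using nl by (auto simp: later_def t_def)
        qed
        then have ne: "u \<noteq> x" and "y' = y"
          using late_end[OF y'N] y' pos_xu less by (auto simp: W_def)
        then have "pos x < pos u" using pos_xu inj_pos uN xN by (auto simp: inj_on_def order_less_le)
        then show False
          using nl \<open>T y' = t\<close> \<open>y' = y\<close> less T_u by (auto simp: later_def t_def)
      qed
    qed
  qed
  then obtain w where w: "w \<in> W" "w \<notin> I" by blast
  then have wN: "w \<in> N" "pos u \<le> pos w" by (auto simp: W_def)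
  have "pos z < pos w" if "z \<in> I" for z
    using I_convex[OF uI that wN(1,2)] w(2) by force
  \<comment> \<open>Only an end of \<open>xy\<close> is incorporated at time \<open>t\<close>, and
    both ends are in \<open>I\<close>.\<close>
  moreover have "T w < t" using w late_end[OF wN(1)] xI yI by (auto simp: W_def)
  ultimately show ?thesis using xI yI wN unfolding t_def by blast
qed

lemma no_deviation: False
proof -
  interpret refl: line_deviation N I "\<lambda>v. - pos v" T g g' d c by (rule reflected)
  obtain x y w where r: "x \<in> I" "y \<in> I" "w \<in> N" "\<And>z. z \<in> I \<Longrightarrow> pos z < pos w" "T w < max (T x) (T y)"
    using early_node_on_right by blast
  obtain x' y' w' where l: "x' \<in> I" "y' \<in> I" "w' \<in> N" "\<And>z. z \<in> I \<Longrightarrow> pos w' < pos z" "T w' < max (T x') (T y')"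
    using refl.early_node_on_right by auto
  \<comment> \<open>Applied to the ends of both pairs, this bounds both routing times by the later
    of \<open>w\<close> and \<open>w'\<close>, which however precedes the routing of its own
    pair.\<close>
  have "T z \<le> max (T w') (T w)" if "z \<in> I" for z
    using T_convex[of w' z w] l(3) r(3) l(4)[OF that] r(4)[OF that] that I_subset by auto
  then have "max (T x) (T y) \<le> max (T w') (T w)" "max (T x') (T y') \<le> max (T w') (T w)"
    using r(1,2) l(1,2) by simp_all
  with r(5) l(5) show False by (simp add: max_def split: if_splits)
qed

end

subsection \<open>Paths of a path graph\<close>

lemma list_edges_append:
  "list_edges (xs @ y # ys) = list_edges (xs @ [y]) \<union> list_edges (y # ys)"
  by (induction xs rule: list_edges.induct) (cases ys; auto)+

lemma list_edges_rev: "list_edges (rev xs) = list_edges xs"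
proof (induction xs rule: list_edges.induct)
  case (1 x y zs)
  then show ?case
    using list_edges_append[of "rev zs" y "[x]"] by (auto simp: insert_commute)
qed auto

lemma list_edges_subset: "list_edges xs \<subseteq> Pow (set xs)"
  by (induction xs rule: list_edges.induct) auto

lemma card_list_edges: "distinct xs \<Longrightarrow> card (list_edges xs) = length xs - 1"
proof (induction xs rule: list_edges.induct)
  case (1 x y zs)
  have "finite (list_edges (y # zs))"
    by (rule finite_subset[of _ "Pow (set (y # zs))"]) (simp_all only: list_edges_subset, simp)
  moreover have "{x, y} \<notin> list_edges (y # zs)"
    using 1 list_edges_subset[of "y # zs"] by auto
  ultimately show ?case using 1 by simp
qed auto

lemma list_edges_conv_nth: "list_edges xs = (\<lambda>i. {xs ! i, xs ! Suc i}) ` {..<length xs - 1}"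
  by (induction xs rule: list_edges.induct) (simp_all add: lessThan_Suc_eq_insert_0 image_image)

lemma paths_commute: "paths \<Gamma> u v = paths \<Gamma> v u"
proof -
  have "paths \<Gamma> u v \<subseteq> paths \<Gamma> v u" for u v
  proof
    fix P assume "P \<in> paths \<Gamma> u v"
    then obtain p where "P = (set p, list_edges p)" "p \<noteq> []" "distinct p" "hd p = u" "last p = v"
        "set p \<subseteq> nodes \<Gamma>" "list_edges p \<subseteq> supply_edges \<Gamma>"
      by (auto simp: paths_def)
    then show "P \<in> paths \<Gamma> v u"
      unfolding paths_def by (intro CollectI exI[of _ "rev p"]) (auto simp: list_edges_rev hd_rev last_rev)
  qed
  then show ?thesis by blast
qed

text \<open>A duplicate-free walk on the integer line cannot turn around.\<close>

lemma distinct_walk_interval: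
  assumes "distinct ks" "ks \<noteq> []"
    and "\<And>a b. {a, b} \<in> list_edges ks \<Longrightarrow> b = Suc a \<or> a = Suc b"
  shows "\<exists>i j. i \<le> j \<and> (ks = [i..<Suc j] \<or> ks = rev [i..<Suc j])"
  using assms
proof (induction ks rule: list_edges.induct)
  case (1 k l ks)
  have "distinct (l # ks)" "l # ks \<noteq> []"
    "\<And>a b. {a, b} \<in> list_edges (l # ks) \<Longrightarrow> b = Suc a \<or> a = Suc b"
    using 1(2,4) by auto
  then obtain i j where ij: "i \<le> j" "l # ks = [i..<Suc j] \<or> l # ks = rev [i..<Suc j]"
    using 1(1) by blast
  have kl: "k = Suc l \<or> l = Suc k" and kn: "k \<notin> set (l # ks)"
    using 1(2) 1(4)[of k l] by auto
  have "set (l # ks) = {i..j}"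
    using ij(2) by (metis atLeastLessThanSuc_atLeastAtMost set_rev set_upt)
  then have kn: "k \<notin> {i..j}" using kn by blast
  show ?case
  proof (cases "l # ks = [i..<Suc j]")
    case True
    then have l: "l = i" using ij(1) by (metis hd_upt le_imp_less_Suc list.sel(1))
    show ?thesis
    proof (cases "l = Suc k")
      case True
      then have "k # l # ks = [k..<Suc j]"
        using \<open>l # ks = _\<close> l ij(1) by (simp add: upt_conv_Cons del: upt_Suc)
      then show ?thesis using l True ij(1) by (intro exI[of _ k] exI[of _ j]) auto
    next
      case False
      then have "k = Suc l" using kl by simp
      \<comment> \<open>A step upwards from the lower end \<open>i\<close> would revisit the
        interval unless it is a single point.\<close>
      then have "j = i" using kn l ij(1) by auto
      then have "k # l # ks = rev [i..<Suc k]" using \<open>l # ks = _\<close> \<open>k = Suc l\<close> l by simp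
      then show ?thesis using \<open>k = Suc l\<close> l by (intro exI[of _ i] exI[of _ k]) auto
    qed
  next
    case decr: False
    then have r: "l # ks = rev [i..<Suc j]" using ij by simp
    then have l: "l = j" using ij(1) by simp
    show ?thesis
    proof (cases "k = Suc l")
      case True
      then have "k # l # ks = rev [i..<Suc k]" using r l ij(1) by simp
      then show ?thesis using l True ij(1) by (intro exI[of _ i] exI[of _ k]) auto
    next
      case False
      then have "l = Suc k" using kl by simp
      then have "j = i" using kn l ij(1) by auto
      \<comment> \<open>A one-element list equals its reversal, so this was the increasing
        case.\<close>
      then show ?thesis using r decr by simp
    qed
  qed
next
  case ("2_2" k)
  have "[k] = [k..<Suc k]" by simp
  then show ?case by blast
qed auto

text \<open>Coordinates are indices along the supply path, taken as integers so that negation can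
  reflect the line. Uniqueness of paths comes from \<open>distinct_walk_interval\<close>, applied to
  the indices of the visited nodes.\<close>

lemma supply_path_coordinates:
  assumes "supply_is_path \<Gamma>"
  obtains pos :: "'v \<Rightarrow> int" where "inj_on pos (nodes \<Gamma>)"
    and "\<And>u v. {u, v} \<in> supply_edges \<Gamma> \<Longrightarrow> \<bar>pos u - pos v\<bar> = 1"
    and "\<And>u v. u \<in> nodes \<Gamma> \<Longrightarrow> v \<in> nodes \<Gamma> \<Longrightarrow> \<exists>P. paths \<Gamma> u v = {P} \<and>
       path_nodes P = {w \<in> nodes \<Gamma>. between pos u w v} \<and>
       card (path_edges P) = nat \<bar>pos u - pos v\<bar>"
proof -
  obtain p where p: "p \<noteq> []" "distinct p" "nodes \<Gamma> = set p" "supply_edges \<Gamma> = list_edges p"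
    using assms by (auto simp: supply_is_path_def)
  define idx where "idx v = (THE i. i < length p \<and> p ! i = v)" for v
  have idx_nth: "idx (p ! i) = i" if "i < length p" for i
    unfolding idx_def by (rule the_equality) (use that p(2) in \<open>auto simp: nth_eq_iff_index_eq\<close>)
  have idx: "idx v < length p \<and> p ! idx v = v" if "v \<in> set p" for v
    using that idx_nth by (auto simp: in_set_conv_nth)
  define pos where "pos v = int (idx v)" for v
  have adj: "idx v = Suc (idx u) \<or> idx u = Suc (idx v)" if uv: "{u, v} \<in> list_edges p" for u v
  proof -
    obtain i where "{u, v} = {p ! i, p ! Suc i}" "Suc i < length p"
      using uv unfolding list_edges_conv_nth by (auto simp: less_diff_conv)
    then show ?thesis using idx_nth[of i] idx_nth[of "Suc i"] by (auto simp: doubleton_eq_iff)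
  qed
  have seg_nodes: "set (map ((!) p) [i..<Suc j]) = {w \<in> set p. i \<le> idx w \<and> idx w \<le> j}"
    if "j < length p" for i j
  proof -
    have "w \<in> (!) p ` {i..<Suc j}" if "w \<in> set p" "i \<le> idx w" "idx w \<le> j" for w
      using that idx[of w] by (intro image_eqI[of _ _ "idx w"]) auto
    then show ?thesis using that idx_nth by (auto simp del: upt_Suc)
  qed
  \<comment> \<open>Only the left-to-right case is worked out; \<open>paths_commute\<close> gives
    the other one.\<close>
  have path: "\<exists>P. paths \<Gamma> u v = {P} \<and>
       path_nodes P = {w \<in> nodes \<Gamma>. min (pos u) (pos v) \<le> pos w \<and> pos w \<le> max (pos u) (pos v)} \<and>
       card (path_edges P) = nat \<bar>pos u - pos v\<bar>"
    if uv: "u \<in> nodes \<Gamma>" "v \<in> nodes \<Gamma>" "pos u \<le> pos v" for u v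
  proof -
    define q where "q = map ((!) p) [idx u..<Suc (idx v)]"
    have le: "idx u \<le> idx v" using uv by (simp add: pos_def)
    have v: "idx v < length p" "p ! idx v = v" "p ! idx u = u" using uv idx p(3) by auto
    have len: "length q = Suc (idx v) - idx u" by (simp add: q_def del: upt_Suc)
    have qn: "set q = {w \<in> set p. idx u \<le> idx w \<and> idx w \<le> idx v}"
      unfolding q_def using seg_nodes[OF v(1)] .
    have dq: "distinct q"
      using v(1) p(2) by (auto simp: q_def distinct_map inj_on_def nth_eq_iff_index_eq simp del: upt_Suc)
    have "q \<noteq> []" "hd q = u" "last q = v"
      using le v by (auto simp: q_def hd_map last_map simp del: upt_Suc simp: hd_upt)
    moreover have "list_edges q \<subseteq> list_edges p"
    proof
      fix e assume "e \<in> list_edges q"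
      then obtain n where "n < length q - 1" "e = {q ! n, q ! Suc n}"
        unfolding list_edges_conv_nth by blast
      then have "idx u + n < length p - 1" "e = {p ! (idx u + n), p ! Suc (idx u + n)}"
        using v(1) len by (auto simp: q_def simp del: upt_Suc)
      then show "e \<in> list_edges p" unfolding list_edges_conv_nth by blast
    qed
    ultimately have mem: "(set q, list_edges q) \<in> paths \<Gamma> u v"
      unfolding paths_def using dq qn p by (intro CollectI exI[of _ q]) auto
    have unique: "P = (set q, list_edges q)" if P: "P \<in> paths \<Gamma> u v" for P
    proof -
      obtain q' where q': "P = (set q', list_edges q')" "q' \<noteq> []" "distinct q'" "hd q' = u" "last q' = v"
          "set q' \<subseteq> set p" "list_edges q' \<subseteq> list_edges p"
        using P p by (auto simp: paths_def)
      define ks where "ks = map idx q'"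
      have q'_ks: "q' = map ((!) p) ks"
        unfolding ks_def using q'(6) idx by (simp add: map_idI subset_iff)
      have inj: "inj_on idx (set q')" using q'(6) idx by (metis inj_onI subsetD)
      have "\<exists>i j. i \<le> j \<and> (ks = [i..<Suc j] \<or> ks = rev [i..<Suc j])"
      proof (rule distinct_walk_interval)
        show "distinct ks" using q' inj by (simp add: ks_def distinct_map)
        show "ks \<noteq> []" using q' by (simp add: ks_def)
        show "b = Suc a \<or> a = Suc b" if ab: "{a, b} \<in> list_edges ks" for a b
        proof -
          obtain n where n: "{a, b} = {ks ! n, ks ! Suc n}" "Suc n < length ks"
            using ab unfolding list_edges_conv_nth by (auto simp: less_diff_conv)
          then have "{q' ! n, q' ! Suc n} \<in> list_edges p"
            using q'(7) unfolding list_edges_conv_nth[of q'] by (force simp: ks_def)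
          from adj[OF this] n show ?thesis by (auto simp: ks_def doubleton_eq_iff)
        qed
      qed
      then obtain i j where ij: "i \<le> j" "ks = [i..<Suc j] \<or> ks = rev [i..<Suc j]" by blast
      have ends: "hd ks = idx u" "last ks = idx v"
        using q' by (auto simp: ks_def hd_map last_map)
      have "set q' = set q \<and> list_edges q' = list_edges q"
      proof (cases "ks = [i..<Suc j]")
        case True
        then have "i = idx u" "j = idx v"
          using ends ij(1) by (auto simp: hd_upt simp del: upt_Suc)
        then have "q' = q" using q'_ks True by (simp add: q_def)
        then show ?thesis by simp
      next
        case False
        then have r: "ks = rev [i..<Suc j]" using ij by simp
        then have "j = idx u" "i = idx v"
          using ends ij(1) by (auto simp: hd_rev last_rev hd_upt simp del: upt_Suc)
        \<comment> \<open>Here \<open>j = idx u\<close> and \<open>i = idx v\<close>, so together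
          with \<open>le\<close> the walk is a single node.\<close>
        then have "q' = rev q" using q'_ks r le ij(1) by (simp add: q_def rev_map del: upt_Suc)
        then show ?thesis by (simp add: list_edges_rev)
      qed
      then show ?thesis using q' by simp
    qed
    have "paths \<Gamma> u v = {(set q, list_edges q)}" using mem unique by blast
    moreover have "set q = {w \<in> nodes \<Gamma>. min (pos u) (pos v) \<le> pos w \<and> pos w \<le> max (pos u) (pos v)}"
      using qn le by (auto simp: pos_def p(3))
    moreover have "card (list_edges q) = nat \<bar>pos u - pos v\<bar>"
      using card_list_edges[OF dq] len le by (simp add: pos_def)
    ultimately show ?thesis by auto
  qed
  show thesis
  proof (rule that[of pos])
    show "inj_on pos (nodes \<Gamma>)"
      unfolding pos_def inj_on_def p(3) using idx by (metis of_nat_eq_iff)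
    show "\<bar>pos u - pos v\<bar> = 1" if "{u, v} \<in> supply_edges \<Gamma>" for u v
      using adj that p(4) by (fastforce simp: pos_def)
    show "\<exists>P. paths \<Gamma> u v = {P} \<and>
       path_nodes P = {w \<in> nodes \<Gamma>. between pos u w v} \<and>
       card (path_edges P) = nat \<bar>pos u - pos v\<bar>"
      if "u \<in> nodes \<Gamma>" "v \<in> nodes \<Gamma>" for u v
    proof (cases "pos u \<le> pos v")
      case True
      then show ?thesis using path that unfolding between_def by blast
    next
      case False
      then show ?thesis
        using path[OF that(2,1)]
        by (simp add: between_def paths_commute[of \<Gamma> v u] min.commute max.commute abs_minus_commute)
    qed
  qed
qed

subsection \<open>Invariants of the algorithm\<close>

lemma the_path_commute: "the_path \<Gamma> u v = the_path \<Gamma> v u"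
  by (simp add: the_path_def paths_commute)

text \<open>On a path graph a flow is one number per commodity. The default 0 off the commodities
  lets payoffs and loads be sums over all nodes.\<close>

definition pair_flow :: "'v mcf_game \<Rightarrow> ('v path \<Rightarrow> real) \<Rightarrow> 'v \<Rightarrow> 'v \<Rightarrow> real" where
  "pair_flow \<Gamma> f x y = (if {x, y} \<in> commodities \<Gamma> then f (the_path \<Gamma> x y) else 0)"

definition pair_demand :: "'v mcf_game \<Rightarrow> 'v \<Rightarrow> 'v \<Rightarrow> real" where
  "pair_demand \<Gamma> x y = (if {x, y} \<in> commodities \<Gamma> then demand \<Gamma> {x, y} else 0)"

lemma pair_flow_commute: "pair_flow \<Gamma> f x y = pair_flow \<Gamma> f y x"
  by (simp add: pair_flow_def insert_commute[of x] the_path_commute[of _ x])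

lemma pair_demand_commute: "pair_demand \<Gamma> x y = pair_demand \<Gamma> y x"
  by (simp add: pair_demand_def insert_commute[of x])

section \<open>Path flows rewritten as flows between pairs of nodes\<close>

locale path_game =
  fixes \<Gamma> :: "'v mcf_game" and pos :: "'v \<Rightarrow> int"
  assumes game: "mcf_game \<Gamma>"
    and inj_pos: "inj_on pos (nodes \<Gamma>)"
    and adjacent: "{u, v} \<in> supply_edges \<Gamma> \<Longrightarrow> \<bar>pos u - pos v\<bar> = 1"
    and unique_path: "\<lbrakk>u \<in> nodes \<Gamma>; v \<in> nodes \<Gamma>\<rbrakk> \<Longrightarrow> \<exists>P. paths \<Gamma> u v = {P} \<and>
       path_nodes P = {w \<in> nodes \<Gamma>. between pos u w v} \<and> card (path_edges P) = nat \<bar>pos u - pos v\<bar>"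
begin

lemma finite_nodes: "finite (nodes \<Gamma>)"
  using game by (simp add: mcf_game_def simple_graph_def)

lemma cap_nonneg: "v \<in> nodes \<Gamma> \<Longrightarrow> 0 \<le> cap \<Gamma> v"
  using game by (simp add: mcf_game_def)

lemma demand_nonneg: "e \<in> commodities \<Gamma> \<Longrightarrow> 0 \<le> demand \<Gamma> e"
  using game by (simp add: mcf_game_def)

lemma commodity_subset: "e \<in> commodities \<Gamma> \<Longrightarrow> e \<subseteq> nodes \<Gamma>"
  using game by (simp add: mcf_game_def simple_graph_def)

lemma commodity_nodes: "{x, y} \<in> commodities \<Gamma> \<Longrightarrow> x \<in> nodes \<Gamma> \<and> y \<in> nodes \<Gamma>"
  using commodity_subset by blast

lemma
  assumes "u \<in> nodes \<Gamma>" "v \<in> nodes \<Gamma>"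
  shows paths_eq: "paths \<Gamma> u v = {the_path \<Gamma> u v}"
    and the_path_nodes: "path_nodes (the_path \<Gamma> u v) = {w \<in> nodes \<Gamma>. between pos u w v}"
    and supply_dist_eq: "supply_dist \<Gamma> u v = nat \<bar>pos u - pos v\<bar>"
proof -
  obtain P where P: "paths \<Gamma> u v = {P}" "path_nodes P = {w \<in> nodes \<Gamma>. between pos u w v}"
    "card (path_edges P) = nat \<bar>pos u - pos v\<bar>"
    using unique_path[OF assms] by blast
  then have "the_path \<Gamma> u v = P" by (simp add: the_path_def)
  with P show "paths \<Gamma> u v = {the_path \<Gamma> u v}"
    "path_nodes (the_path \<Gamma> u v) = {w \<in> nodes \<Gamma>. between pos u w v}" by simp_all
  show "supply_dist \<Gamma> u v = nat \<bar>pos u - pos v\<bar>"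
    unfolding supply_dist_def using P by (auto intro: Least_equality)
qed

text \<open>The ends are recovered as the nodes at the extreme positions of the path.\<close>

lemma the_path_inject:
  assumes "x \<in> nodes \<Gamma>" "y \<in> nodes \<Gamma>" "x' \<in> nodes \<Gamma>" "y' \<in> nodes \<Gamma>"
    and eq: "the_path \<Gamma> x y = the_path \<Gamma> x' y'"
  shows "{x, y} = {x', y'}"
proof -
  have bet: "between pos x z y \<longleftrightarrow> between pos x' z y'" if "z \<in> nodes \<Gamma>" for z
    using the_path_nodes[OF assms(1,2)] the_path_nodes[OF assms(3,4)] eq that by auto
  have "min (pos x) (pos y) = min (pos x') (pos y') \<and> max (pos x) (pos y) = max (pos x') (pos y')"
    using bet[OF assms(1)] bet[OF assms(2)] bet[OF assms(3)] bet[OF assms(4)]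
    by (auto simp: between_def min_def max_def split: if_splits)
  then have "pos x = pos x' \<and> pos y = pos y' \<or> pos x = pos y' \<and> pos y = pos x'"
    by (auto simp: min_def max_def split: if_splits)
  then show ?thesis using inj_pos assms(1-4) by (auto simp: inj_on_def)
qed

lemma the_path_commodity_inject:
  assumes "{x, y} \<in> commodities \<Gamma>" "{x', y'} \<in> commodities \<Gamma>"
  shows "the_path \<Gamma> x y = the_path \<Gamma> x' y' \<longleftrightarrow> {x, y} = {x', y'}"
  using the_path_inject commodity_nodes[OF assms(1)] commodity_nodes[OF assms(2)]
  by (metis doubleton_eq_iff the_path_commute)

lemma commodity_paths_eq: "commodity_paths \<Gamma> = {the_path \<Gamma> x y | x y. {x, y} \<in> commodities \<Gamma>}"
proof -
  have "paths \<Gamma> x y = {the_path \<Gamma> x y}" if "{x, y} \<in> commodities \<Gamma>" for x y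
    using paths_eq commodity_nodes[OF that] by blast
  then show ?thesis unfolding commodity_paths_def by blast
qed

lemma finite_commodity_paths: "finite (commodity_paths \<Gamma>)"
proof (rule finite_subset)
  show "commodity_paths \<Gamma> \<subseteq> (\<lambda>(x, y). the_path \<Gamma> x y) ` (nodes \<Gamma> \<times> nodes \<Gamma>)"
    unfolding commodity_paths_eq using commodity_nodes by fastforce
qed (simp add: finite_nodes)

lemma commodity_flow_eq:
  "{x, y} \<in> commodities \<Gamma> \<Longrightarrow> commodity_flow \<Gamma> f x y = f (the_path \<Gamma> x y)"
  using paths_eq commodity_nodes[of x y] by (simp add: commodity_flow_def)

lemma payoff_eq: "payoff \<Gamma> f v = (\<Sum>y\<in>nodes \<Gamma>. pair_flow \<Gamma> f v y)"
proof -
  have "payoff \<Gamma> f v = (\<Sum>w | {w, v} \<in> commodities \<Gamma>. pair_flow \<Gamma> f w v)"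
    unfolding payoff_def by (rule sum.cong) (simp_all add: commodity_flow_eq pair_flow_def)
  also have "\<dots> = (\<Sum>w | {w, v} \<in> commodities \<Gamma>. pair_flow \<Gamma> f v w)"
    by (rule sum.cong[OF refl]) (rule pair_flow_commute)
  also have "\<dots> = (\<Sum>y\<in>nodes \<Gamma>. pair_flow \<Gamma> f v y)"
    by (rule sum.mono_neutral_left)
       (use finite_nodes commodity_nodes in \<open>auto simp: pair_flow_def insert_commute\<close>)
  finally show ?thesis .
qed

text \<open>Each commodity path through \<open>u\<close> comes from exactly one of the ordered pairs
  counted by \<open>load\<close>, so the sum over paths can be reindexed by those pairs.\<close>

lemma path_load_eq:
  assumes u: "u \<in> nodes \<Gamma>"
  shows "(\<Sum>P | P \<in> commodity_paths \<Gamma> \<and> u \<in> path_nodes P. f P) = load (nodes \<Gamma>) pos (pair_flow \<Gamma> f) u"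
proof -
  let ?B = "{y \<in> nodes \<Gamma>. pos u \<le> pos y} \<times> {x \<in> nodes \<Gamma>. pos x \<le> pos u}"
  let ?A = "{(y, x) \<in> ?B. {y, x} \<in> commodities \<Gamma>}"
  have inj: "inj_on (\<lambda>(y, x). the_path \<Gamma> y x) ?A"
  proof (rule inj_onI, clarify)
    fix y x y' x'
    assume *: "{y, x} \<in> commodities \<Gamma>" "{y', x'} \<in> commodities \<Gamma>" "the_path \<Gamma> y x = the_path \<Gamma> y' x'"
      "pos u \<le> pos y" "pos x \<le> pos u" "pos u \<le> pos y'" "pos x' \<le> pos u"
      "y \<in> nodes \<Gamma>" "x \<in> nodes \<Gamma>"
    then have "{y, x} = {y', x'}" by (simp add: the_path_commodity_inject)
    \<comment> \<open>Both orientations of a pair are counted only if both ends have the position of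
      \<open>u\<close>, that is, if they coincide.\<close>
    moreover have "y = x" if "y = x'" "x = y'"
      using * that inj_pos by (auto simp: inj_on_def)
    ultimately show "y = y' \<and> x = x'" by (auto simp: doubleton_eq_iff)
  qed
  have img: "(\<lambda>(y, x). the_path \<Gamma> y x) ` ?A = {P \<in> commodity_paths \<Gamma>. u \<in> path_nodes P}"
  proof (intro equalityI subsetI)
    fix P assume "P \<in> (\<lambda>(y, x). the_path \<Gamma> y x) ` ?A"
    then obtain y x where "P = the_path \<Gamma> y x" "{y, x} \<in> commodities \<Gamma>" "pos u \<le> pos y" "pos x \<le> pos u"
        "y \<in> nodes \<Gamma>" "x \<in> nodes \<Gamma>"
      by auto
    then show "P \<in> {P \<in> commodity_paths \<Gamma>. u \<in> path_nodes P}"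
      using u by (auto simp: commodity_paths_eq the_path_nodes between_def)
  next
    fix P assume "P \<in> {P \<in> commodity_paths \<Gamma>. u \<in> path_nodes P}"
    then obtain y x where P: "P = the_path \<Gamma> y x" "{y, x} \<in> commodities \<Gamma>" "u \<in> path_nodes P"
      by (auto simp: commodity_paths_eq)
    note yx = commodity_nodes[OF P(2)]
    then have bet: "between pos y u x" using P by (auto simp: the_path_nodes)
    show "P \<in> (\<lambda>(y, x). the_path \<Gamma> y x) ` ?A"
    proof (cases "pos x \<le> pos y")
      case True
      then show ?thesis using P yx bet by (intro image_eqI[of _ _ "(y, x)"]) (auto simp: between_def)
    next
      case False
      then show ?thesis using P yx bet
        by (intro image_eqI[of _ _ "(x, y)"])
           (auto simp: between_def the_path_commute[of _ y] insert_commute[of y])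
    qed
  qed
  have "load (nodes \<Gamma>) pos (pair_flow \<Gamma> f) u = (\<Sum>(y, x)\<in>?B. pair_flow \<Gamma> f y x)"
    unfolding load_def by (rule sum.cartesian_product)
  also have "\<dots> = (\<Sum>(y, x)\<in>?A. pair_flow \<Gamma> f y x)"
    by (rule sum.mono_neutral_right) (auto simp: finite_nodes pair_flow_def split: if_splits)
  also have "\<dots> = (\<Sum>p\<in>?A. f ((\<lambda>(y, x). the_path \<Gamma> y x) p))"
    by (rule sum.cong) (auto simp: pair_flow_def)
  also have "\<dots> = (\<Sum>P\<in>(\<lambda>(y, x). the_path \<Gamma> y x) ` ?A. f P)"
    by (subst sum.reindex[OF inj]) (simp only: comp_def)
  finally show ?thesis unfolding img by simp
qed

section \<open>Routing: exhausted nodes stay exhausted\<close>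

definition routed :: "('v \<Rightarrow> nat) \<Rightarrow> 'v set set \<Rightarrow> ('v path \<Rightarrow> real) \<Rightarrow> ('v \<Rightarrow> real) \<Rightarrow> bool" where
  "routed T D f C \<longleftrightarrow>
     D \<subseteq> commodities \<Gamma> \<and>
     (\<forall>P. 0 \<le> f P) \<and>
     (\<forall>P. f P \<noteq> 0 \<longrightarrow> (\<exists>x y. {x, y} \<in> D \<and> P = the_path \<Gamma> x y)) \<and>
     (\<forall>x y. {x, y} \<in> D \<longrightarrow> f (the_path \<Gamma> x y) \<le> demand \<Gamma> {x, y}) \<and>
     (\<forall>u\<in>nodes \<Gamma>. 0 \<le> C u \<and> C u = cap \<Gamma> u - (\<Sum>P | P \<in> commodity_paths \<Gamma> \<and> u \<in> path_nodes P. f P)) \<and>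
     (\<forall>x y. {x, y} \<in> D \<longrightarrow> f (the_path \<Gamma> x y) = demand \<Gamma> {x, y} \<or>
       (\<exists>u\<in>nodes \<Gamma>. between pos x u y \<and> C u = 0 \<and>
         (\<forall>x' y'. {x', y'} \<in> D \<and> between pos x' u y' \<and> later pos T x' y' x y \<longrightarrow>
           f (the_path \<Gamma> x' y') = 0)))"

text \<open>Needed when a new node receives its time: no commodity routed so far ends at that
  node.\<close>

lemma routed_cong:
  assumes "routed T D f C" "\<And>x. x \<in> \<Union>D \<Longrightarrow> T' x = T x"
  shows "routed T' D f C"
proof -
  have eq: "later pos T' x' y' x y = later pos T x' y' x y" if "{x, y} \<in> D" "{x', y'} \<in> D" for x y x' y'
  proof -
    have "T' x = T x" "T' y = T y" "T' x' = T x'" "T' y' = T y'" using that by (auto intro!: assms(2))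
    then show ?thesis by (simp add: later_def)
  qed
  note inv' = assms(1)[unfolded routed_def]
  have "f (the_path \<Gamma> x y) = demand \<Gamma> {x, y} \<or>
       (\<exists>u\<in>nodes \<Gamma>. between pos x u y \<and> C u = 0 \<and>
         (\<forall>x' y'. {x', y'} \<in> D \<and> between pos x' u y' \<and> later pos T' x' y' x y \<longrightarrow>
           f (the_path \<Gamma> x' y') = 0))" if xy: "{x, y} \<in> D" for x y
  proof (cases "f (the_path \<Gamma> x y) = demand \<Gamma> {x, y}")
    case False
    then obtain u where "u \<in> nodes \<Gamma>" "between pos x u y" "C u = 0"
      and zero: "\<And>x' y'. \<lbrakk>{x', y'} \<in> D; between pos x' u y'; later pos T x' y' x y\<rbrakk> \<Longrightarrow>
         f (the_path \<Gamma> x' y') = 0"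
      using inv' xy by blast
    moreover have "f (the_path \<Gamma> x' y') = 0"
      if *: "{x', y'} \<in> D" "between pos x' u y'" "later pos T' x' y' x y" for x' y'
      using zero[OF *(1,2)] eq[OF xy *(1)] *(3) by simp
    ultimately show ?thesis by blast
  qed simp
  then show ?thesis using inv' unfolding routed_def by (intro conjI; blast)
qed

text \<open>The last clause of \<open>routed\<close> is the blocker condition relative to the
  commodities \<open>D\<close> routed so far. If \<open>kv\<close> falls short of its demand, the
  minimum residual capacity is attained at a node that drops to 0, and nothing routed is later than
  \<open>kv\<close>. An older blocker keeps its role: if it lies on the path of \<open>kv\<close>,
  its zero residual forces the new flow to be 0.\<close>

lemma routed_route:
  assumes inv: "routed T D f C"
    and kv: "{k, v} \<in> commodities \<Gamma>" "{k, v} \<notin> D"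
    and not_later: "\<And>x y. {x, y} \<in> D \<Longrightarrow> \<not> later pos T x y k v"
    and route: "route \<Gamma> v k (f, C) = (f', C')"
  shows "routed T (insert {k, v} D) f' C'"
proof -
  note inv' = inv[unfolded routed_def]
  have f_nonneg: "0 \<le> f P" for P using inv' by blast
  have f_supp: "\<exists>x y. {x, y} \<in> D \<and> P = the_path \<Gamma> x y" if "f P \<noteq> 0" for P
    using inv' that by blast
  have D: "D \<subseteq> commodities \<Gamma>" using inv' by blast
  have C: "0 \<le> C u" "C u = cap \<Gamma> u - (\<Sum>P | P \<in> commodity_paths \<Gamma> \<and> u \<in> path_nodes P. f P)"
    if "u \<in> nodes \<Gamma>" for u using inv' that by blast+
  define Q where "Q = the_path \<Gamma> k v"
  define x where "x = min (demand \<Gamma> {k, v}) (Min (C ` path_nodes Q))"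
  have f': "f' = f(Q := x)" and C': "C' = (\<lambda>u. if u \<in> path_nodes Q then C u - x else C u)"
    using route kv(1) by (auto simp: route_def Let_def Q_def x_def)
  have kvN: "k \<in> nodes \<Gamma>" "v \<in> nodes \<Gamma>" using commodity_nodes[OF kv(1)] by auto
  have Q: "path_nodes Q = {w \<in> nodes \<Gamma>. between pos k w v}"
    unfolding Q_def by (rule the_path_nodes[OF kvN])
  have fin: "finite (C ` path_nodes Q)" and ne: "C ` path_nodes Q \<noteq> {}"
    using kvN finite_nodes by (auto simp: Q between_def intro!: exI[of _ k])
  have x_le: "x \<le> C u" if "u \<in> path_nodes Q" for u
    using that fin by (auto simp: x_def intro: min.coboundedI2)
  have x_nonneg: "0 \<le> x"
    using demand_nonneg[OF kv(1)] C(1) fin ne by (auto simp: x_def Q)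
  have Q_cp: "Q \<in> commodity_paths \<Gamma>" using kv by (auto simp: commodity_paths_eq Q_def)
  have Q_eq: "the_path \<Gamma> a b = Q \<longleftrightarrow> {a, b} = {k, v}" if "{a, b} \<in> commodities \<Gamma>" for a b
    unfolding Q_def by (rule the_path_commodity_inject[OF that kv(1)])
  \<comment> \<open>No routed commodity has the path \<open>Q\<close>, so the update of
    \<open>f\<close> at \<open>Q\<close> adds \<open>x\<close> and overwrites nothing.\<close>
  have fQ: "f Q = 0"
  proof (rule ccontr)
    assume "f Q \<noteq> 0"
    then obtain a b where "{a, b} \<in> D" "Q = the_path \<Gamma> a b" using inv' by blast
    then show False using Q_eq D kv(2) by (metis subsetD)
  qed
  have f'_old: "f' (the_path \<Gamma> a b) = f (the_path \<Gamma> a b)" if "{a, b} \<in> D" for a b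
    using Q_eq[of a b] that D kv(2) by (auto simp: f')
  have f'_new: "f' (the_path \<Gamma> a b) = x" if "{a, b} = {k, v}" for a b
    using Q_eq[of a b] that kv(1) by (auto simp: f')
  have sum: "(\<Sum>P | P \<in> commodity_paths \<Gamma> \<and> u \<in> path_nodes P. f' P) =
      (\<Sum>P | P \<in> commodity_paths \<Gamma> \<and> u \<in> path_nodes P. f P) + (if u \<in> path_nodes Q then x else 0)" for u
  proof -
    let ?A = "{P. P \<in> commodity_paths \<Gamma> \<and> u \<in> path_nodes P}"
    have fA: "finite ?A" using finite_commodity_paths by simp
    show ?thesis
    proof (cases "u \<in> path_nodes Q")
      case True
      then have "Q \<in> ?A" using Q_cp by simp
      moreover have "sum f' (?A - {Q}) = sum f (?A - {Q})" by (rule sum.cong) (auto simp: f')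
      ultimately show ?thesis
        using sum.remove[OF fA, of Q f] sum.remove[OF fA, of Q f'] True by (simp add: f' fQ)
    next
      case False
      then have "sum f' ?A = sum f ?A" by (intro sum.cong) (auto simp: f')
      then show ?thesis using False by simp
    qed
  qed
  have C'_zero: "C' u = 0" if "u \<in> nodes \<Gamma>" "C u = 0" for u
    using x_le[of u] x_nonneg that by (auto simp: C')
  show ?thesis
    unfolding routed_def
  proof (intro conjI allI impI ballI)
    show "insert {k, v} D \<subseteq> commodities \<Gamma>" using D kv by simp
    show "0 \<le> f' P" for P using f_nonneg x_nonneg by (simp add: f')
    show "\<exists>a b. {a, b} \<in> insert {k, v} D \<and> P = the_path \<Gamma> a b" if "f' P \<noteq> 0" for P
    proof (cases "P = Q")
      case True
      then show ?thesis unfolding Q_def by blast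
    next
      case False
      then show ?thesis using f_supp[of P] that by (auto simp: f')
    qed
    show "f' (the_path \<Gamma> a b) \<le> demand \<Gamma> {a, b}" if "{a, b} \<in> insert {k, v} D" for a b
    proof (cases "{a, b} = {k, v}")
      case True
      then show ?thesis by (simp add: f'_new x_def)
    next
      case False
      then have "{a, b} \<in> D" using that by blast
      then show ?thesis using inv' f'_old by simp
    qed
    fix u assume u: "u \<in> nodes \<Gamma>"
    show "0 \<le> C' u" using C(1)[OF u] x_le by (simp add: C')
    show "C' u = cap \<Gamma> u - (\<Sum>P | P \<in> commodity_paths \<Gamma> \<and> u \<in> path_nodes P. f' P)"
      unfolding sum using C(2)[OF u] by (simp add: C')
  next
    fix a b assume ab: "{a, b} \<in> insert {k, v} D"
    show "f' (the_path \<Gamma> a b) = demand \<Gamma> {a, b} \<or>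
       (\<exists>u\<in>nodes \<Gamma>. between pos a u b \<and> C' u = 0 \<and>
         (\<forall>x' y'. {x', y'} \<in> insert {k, v} D \<and> between pos x' u y' \<and> later pos T x' y' a b \<longrightarrow>
           f' (the_path \<Gamma> x' y') = 0))"
    proof (cases "{a, b} = {k, v}")
      case True
      have between_ab: "between pos a u b = between pos k u v" for u
        using True between_commute[of pos] by (auto simp: doubleton_eq_iff)
      have later_ab: "later pos T x' y' a b = later pos T x' y' k v" for x' y'
        using True later_commute[of pos T] by (auto simp: doubleton_eq_iff)
      show ?thesis
      proof (cases "x = demand \<Gamma> {k, v}")
        case x: False
        then have "x \<in> C ` path_nodes Q" using Min_in[OF fin ne] by (auto simp: x_def min_def)
        then obtain u where u: "u \<in> path_nodes Q" "x = C u" by blast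
        moreover have "\<not> later pos T x' y' k v" if "{x', y'} \<in> insert {k, v} D" for x' y'
        proof (cases "{x', y'} = {k, v}")
          case True
          then show ?thesis by (auto simp: doubleton_eq_iff later_def max.commute abs_minus_commute)
        next
          case False
          then show ?thesis using that not_later by blast
        qed
        ultimately show ?thesis
          unfolding between_ab later_ab by (intro disjI2 bexI[of _ u]) (auto simp: Q C')
      qed (simp add: True f'_new)
    next
      case False
      then have abD: "{a, b} \<in> D" using ab by blast
      show ?thesis
      proof (cases "f (the_path \<Gamma> a b) = demand \<Gamma> {a, b}")
        case True
        then show ?thesis using f'_old[OF abD] by simp
      next
        case False
        then obtain u where u: "u \<in> nodes \<Gamma>" "between pos a u b" "C u = 0"
          and zero: "\<And>x' y'. \<lbrakk>{x', y'} \<in> D; between pos x' u y'; later pos T x' y' a b\<rbrakk> \<Longrightarrow>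
             f (the_path \<Gamma> x' y') = 0"
          using inv' abD by blast
        have "f' (the_path \<Gamma> x' y') = 0"
          if *: "{x', y'} \<in> insert {k, v} D" "between pos x' u y'" "later pos T x' y' a b" for x' y'
        proof (cases "{x', y'} = {k, v}")
          case True
          then have "between pos k u v" using *(2) between_commute[of pos] by (auto simp: doubleton_eq_iff)
          then have "x \<le> 0" using x_le[of u] u by (simp add: Q)
          then show ?thesis using f'_new[OF True] x_nonneg by simp
        next
          case False
          then show ?thesis using zero f'_old * by auto
        qed
        then show ?thesis using u C'_zero by blast
      qed
    qed
  qed
qed

text \<open>All pairs of this round have the time \<open>T v\<close> of the new node, so
  \<open>later\<close> compares only their lengths. Processing the closest nodes first is exactly
  what keeps the premise of \<open>routed_route\<close> that no routed pair is later than the next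
  one.\<close>

lemma routed_fold:
  assumes "routed T D f C" "distinct ks" "set ks \<subseteq> nodes \<Gamma>" "v \<in> nodes \<Gamma>"
    and "sorted_wrt (\<lambda>k l. supply_dist \<Gamma> v k \<le> supply_dist \<Gamma> v l) ks"
    and "\<And>k. k \<in> set ks \<Longrightarrow> T k < T v"
    and "\<And>k. k \<in> set ks \<Longrightarrow> {k, v} \<notin> D"
    and "\<And>k x y. k \<in> set ks \<Longrightarrow> {x, y} \<in> D \<Longrightarrow> \<not> later pos T x y k v"
    and "fold (route \<Gamma> v) ks (f, C) = (f', C')"
  shows "routed T (D \<union> {e \<in> commodities \<Gamma>. \<exists>k\<in>set ks. e = {k, v}}) f' C'"
  using assms
proof (induction ks arbitrary: D f C)
  case Nil
  then show ?case by simp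
next
  case (Cons k ks)
  obtain f1 C1 where r: "route \<Gamma> v k (f, C) = (f1, C1)" by fastforce
  then have rest: "fold (route \<Gamma> v) ks (f1, C1) = (f', C')" using Cons.prems(9) by simp
  show ?case
  proof (cases "{k, v} \<in> commodities \<Gamma>")
    case True
    have "routed T (insert {k, v} D) f1 C1"
      using routed_route[OF Cons.prems(1) True _ _ r] Cons.prems(7,8) by simp
    then have "routed T (insert {k, v} D \<union> {e \<in> commodities \<Gamma>. \<exists>k\<in>set ks. e = {k, v}}) f' C'"
    proof (rule Cons.IH[OF _ _ _ _ _ _ _ _ rest])
      show "{l, v} \<notin> insert {k, v} D" if "l \<in> set ks" for l
        using Cons.prems(2,7) that by (auto simp: doubleton_eq_iff)
      show "\<not> later pos T x y l v" if l: "l \<in> set ks" and xy: "{x, y} \<in> insert {k, v} D" for l x y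
      proof (cases "{x, y} = {k, v}")
        case True
        have "nat \<bar>pos v - pos k\<bar> \<le> nat \<bar>pos v - pos l\<bar>"
          using Cons.prems(3,4,5) l by (simp add: supply_dist_eq subset_iff)
        moreover have "T k < T v" "T l < T v" using Cons.prems(6) l by auto
        ultimately show ?thesis using True
          by (auto simp: doubleton_eq_iff later_def max_def abs_minus_commute)
      next
        case False
        then show ?thesis using Cons.prems(8)[of l x y] l xy by auto
      qed
    qed (use Cons.prems(2-6) in auto)
    moreover have "insert {k, v} D \<union> {e \<in> commodities \<Gamma>. \<exists>k\<in>set ks. e = {k, v}} =
        D \<union> {e \<in> commodities \<Gamma>. \<exists>k\<in>set (k # ks). e = {k, v}}"
      using True by auto
    ultimately show ?thesis by (simp only:)
  next
    case False
    then have "f1 = f" "C1 = C" using r by (auto simp: route_def)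
    with rest have "fold (route \<Gamma> v) ks (f, C) = (f', C')" by simp
    then have "routed T (D \<union> {e \<in> commodities \<Gamma>. \<exists>l\<in>set ks. e = {l, v}}) f' C'"
    proof (rule Cons.IH[OF Cons.prems(1) _ _ Cons.prems(4), rotated -1])
      show "{l, v} \<notin> D" if "l \<in> set ks" for l using Cons.prems(7) that by simp
      show "\<not> later pos T x y l v" if "l \<in> set ks" "{x, y} \<in> D" for l x y
        using Cons.prems(8)[of l x y] that by simp
    qed (use Cons.prems(2,3,5,6) in auto)
    moreover have "{e \<in> commodities \<Gamma>. \<exists>l\<in>set (k # ks). e = {l, v}} =
        {e \<in> commodities \<Gamma>. \<exists>l\<in>set ks. e = {l, v}}"
      using False by auto
    ultimately show ?thesis by (simp only:)
  qed
qed

section \<open>The incorporated nodes form a segment at all times\<close>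

definition ordered :: "('v \<Rightarrow> nat) \<Rightarrow> 'v set \<Rightarrow> bool" where
  "ordered T S \<longleftrightarrow> S \<subseteq> nodes \<Gamma> \<and> inj_on T S \<and>
     (\<forall>x\<in>S. \<forall>z\<in>S. \<forall>y\<in>nodes \<Gamma>. between pos x y z \<longrightarrow> y \<in> S \<and> T y \<le> max (T x) (T z))"

text \<open>The new node extends the segment \<open>S\<close> by a neighbour. Its time exceeds all
  others, so the bound on times is immediate for pairs ending at \<open>v\<close>.\<close>

lemma ordered_insert:
  assumes S: "ordered T S" and v: "v \<in> nodes \<Gamma>" "v \<notin> S"
    and u: "u \<in> S" "{u, v} \<in> supply_edges \<Gamma>" and m: "\<And>x. x \<in> S \<Longrightarrow> T x < m"
  shows "ordered (T(v := m)) (insert v S)"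
proof -
  let ?T = "T(v := m)"
  have SN: "S \<subseteq> nodes \<Gamma>" and inj: "inj_on T S"
    and conv: "\<And>x y z. \<lbrakk>x \<in> S; z \<in> S; y \<in> nodes \<Gamma>; between pos x y z\<rbrakk> \<Longrightarrow> y \<in> S \<and> T y \<le> max (T x) (T z)"
    using S unfolding ordered_def by blast+
  have T_S: "?T x = T x" if "x \<in> S" for x using that v by auto
  have uv: "\<bar>pos u - pos v\<bar> = 1" using adjacent u by blast
  have le_m: "?T y \<le> m" if "y \<in> insert v S" for y using that m by (auto intro: less_imp_le)
  have from_v: "y \<in> insert v S" if "z \<in> S" "y \<in> nodes \<Gamma>" "between pos v y z" for y z
  proof (cases "pos y = pos v")
    case True
    then have "y = v" using inj_pos that v by (auto simp: inj_on_def)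
    then show ?thesis by simp
  next
    case False
    \<comment> \<open>Since \<open>v\<close> is not in \<open>S\<close>, convexity puts
      \<open>u\<close> and \<open>z\<close> on the same side of \<open>v\<close>. As
      \<open>u\<close> is next to \<open>v\<close>, every other node between \<open>v\<close> and
      \<open>z\<close> is between \<open>u\<close> and \<open>z\<close>.\<close>
    then have "between pos u y z"
      using that(3) uv conv[OF u(1) \<open>z \<in> S\<close> v(1)] v(2) by (auto simp: between_def)
    then show ?thesis using conv[OF u(1) that(1,2)] by simp
  qed
  have "y \<in> insert v S \<and> ?T y \<le> max (?T x) (?T z)"
    if xyz: "x \<in> insert v S" "z \<in> insert v S" "y \<in> nodes \<Gamma>" "between pos x y z" for x y z
  proof (cases "x = v \<or> z = v")
    case True
    have "y \<in> insert v S"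
    proof (cases "x = v \<and> z = v")
      case True
      then have "y = v" using xyz v inj_pos by (auto simp: between_def inj_on_def)
      then show ?thesis by simp
    next
      case False
      then show ?thesis
        using True xyz from_v[of z y] from_v[of x y] between_commute[of pos x y z] by auto
    qed
    moreover have "m \<le> max (?T x) (?T z)" using True by auto
    ultimately show ?thesis using le_m order_trans by blast
  next
    case False
    then have "x \<in> S" "z \<in> S" using xyz by auto
    then show ?thesis using conv[of x z y] xyz T_S by auto
  qed
  moreover have "inj_on ?T (insert v S)"
  proof (rule inj_onI)
    fix x y assume "x \<in> insert v S" "y \<in> insert v S" "?T x = ?T y"
    then show "x = y"
      using inj m[of x] m[of y] by (auto simp: inj_on_def split: if_splits)
  qed
  ultimately show ?thesis using SN v(1) unfolding ordered_def by blast
qed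

text \<open>The algorithm does not record times of incorporation; a suitable \<open>T\<close> is
  built along the run, giving each new node a time above all previous ones.\<close>

lemma incorporate_invariant:
  assumes "incorporate_reaches \<Gamma> r S f C" "r \<in> nodes \<Gamma>"
  shows "\<exists>T. ordered T S \<and> routed T {e \<in> commodities \<Gamma>. e \<subseteq> S} f C"
  using assms
proof (induction rule: incorporate_reaches.induct)
  case init
  \<comment> \<open>A commodity has two distinct ends, so at the start nothing counts as
    routed.\<close>
  have no_loop: "{e \<in> commodities \<Gamma>. e \<subseteq> {r}} = {}"
    using game by (auto simp: mcf_game_def simple_graph_def subset_singleton_iff)
  have "ordered (\<lambda>_. 0) {r}"
    using init inj_pos by (auto simp: ordered_def between_def inj_on_def)
  then show ?case unfolding no_loop using cap_nonneg by (auto simp: routed_def)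
next
  case (step S f C v ks f' C')
  then obtain T where T: "ordered T S" "routed T {e \<in> commodities \<Gamma>. e \<subseteq> S} f C" by blast
  have SN: "S \<subseteq> nodes \<Gamma>" using T by (simp add: ordered_def)
  then have "finite (T ` S)" using finite_nodes finite_subset by blast
  then obtain m where m: "\<And>x. x \<in> S \<Longrightarrow> T x < m"
    unfolding finite_nat_set_iff_bounded by blast
  let ?T = "T(v := m)" and ?D = "{e \<in> commodities \<Gamma>. e \<subseteq> S}"
  have T_S: "?T x = T x" if "x \<in> S" for x using that step by auto
  obtain u where "u \<in> S" "{u, v} \<in> supply_edges \<Gamma>" using step by blast
  then have ord: "ordered ?T (insert v S)"
    using ordered_insert T step m by blast
  have "routed ?T ?D f C"
    by (rule routed_cong[OF T(2)]) (use \<open>v \<notin> S\<close> in auto)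
  then have "routed ?T (?D \<union> {e \<in> commodities \<Gamma>. \<exists>k\<in>set ks. e = {k, v}}) f' C'"
  proof (rule routed_fold)
    show "\<not> later pos ?T x y k v" if "k \<in> set ks" "{x, y} \<in> ?D" for k x y
      using that m[of x] m[of y] m[of k] T_S step by (auto simp: later_def)
  qed (use step SN m in auto)
  \<comment> \<open>A commodity that lies in \<open>insert v S\<close> but not in \<open>S\<close>
    joins \<open>v\<close> to an old node, so this round has routed it.\<close>
  moreover have "?D \<union> {e \<in> commodities \<Gamma>. \<exists>k\<in>set ks. e = {k, v}} = {e \<in> commodities \<Gamma>. e \<subseteq> insert v S}"
  proof -
    have "\<exists>k\<in>S. e = {k, v}" if e: "e \<in> commodities \<Gamma>" "e \<subseteq> insert v S" "\<not> e \<subseteq> S" for e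
    proof -
      have "card e = 2" using game e(1) by (simp add: mcf_game_def simple_graph_def)
      then obtain a b where "e = {a, b}" "a \<noteq> b" by (auto simp: card_2_iff)
      then show ?thesis using e by (auto simp: insert_commute)
    qed
    then show ?thesis using step by auto
  qed
  ultimately show ?case using ord by auto
qed

section \<open>From the returned flow to a core payoff\<close>

lemma returned_flow_in_core:
  assumes "r \<in> nodes \<Gamma>" "incorporate_returns \<Gamma> r f"
  shows "payoff \<Gamma> f \<in> core \<Gamma>"
proof -
  let ?N = "nodes \<Gamma>"
  obtain C where "incorporate_reaches \<Gamma> r ?N f C"
    using assms by (auto simp: incorporate_returns_def)
  then obtain T where ord: "ordered T ?N" and "routed T {e \<in> commodities \<Gamma>. e \<subseteq> ?N} f C"
    using incorporate_invariant assms by blast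
  moreover have "{e \<in> commodities \<Gamma>. e \<subseteq> ?N} = commodities \<Gamma>" using commodity_subset by blast
  ultimately have inv: "routed T (commodities \<Gamma>) f C" by simp
  note inv' = inv[unfolded routed_def]
  have f_nonneg: "0 \<le> f P" for P using inv' by blast
  have "feasible \<Gamma> f"
    unfolding feasible_def
  proof (intro conjI allI impI ballI)
    show "0 \<le> f P" for P by (rule f_nonneg)
    show "f P = 0" if "P \<notin> commodity_paths \<Gamma>" for P
      using inv' that unfolding commodity_paths_eq by blast
    show "(\<Sum>P | P \<in> commodity_paths \<Gamma> \<and> v \<in> path_nodes P. f P) \<le> cap \<Gamma> v" if "v \<in> ?N" for v
    proof -
      have "0 \<le> C v" "C v = cap \<Gamma> v - (\<Sum>P | P \<in> commodity_paths \<Gamma> \<and> v \<in> path_nodes P. f P)"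
        using inv' that by blast+
      then show ?thesis by linarith
    qed
    show "commodity_flow \<Gamma> f u v \<le> demand \<Gamma> {u, v}" if "{u, v} \<in> commodities \<Gamma>" for u v
      using inv' that by (simp add: commodity_flow_eq)
  qed
  moreover have "path_nodes P \<subseteq> ?N" if P: "f P \<noteq> 0" for P
  proof -
    obtain x y where "{x, y} \<in> commodities \<Gamma>" "P = the_path \<Gamma> x y" using inv' P by blast
    then show ?thesis using commodity_nodes[of x y] by (auto simp: the_path_nodes)
  qed
  ultimately have "payoff \<Gamma> f \<in> payoffs \<Gamma> ?N"
    unfolding payoffs_def flows_within_def by blast
  moreover have "\<not> breakaway \<Gamma> (payoff \<Gamma> f) S" for S
  proof
    assume "breakaway \<Gamma> (payoff \<Gamma> f) S"
    then obtain \<pi>' where S: "S \<noteq> {}" "S \<subset> ?N" and \<pi>': "\<pi>' \<in> payoffs \<Gamma> S" "\<forall>v\<in>S. payoff \<Gamma> f v < \<pi>' v"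
      unfolding breakaway_def by blast
    then obtain f' where f'_within: "f' \<in> flows_within \<Gamma> S" and \<pi>'_eq: "\<pi>' = payoff \<Gamma> f'"
      unfolding payoffs_def by blast
    have f': "feasible \<Gamma> f'" using f'_within by (simp add: flows_within_def)
    have f'_S: "path_nodes P \<subseteq> S" if "f' P \<noteq> 0" for P
      using f'_within that unfolding flows_within_def by blast
    have gain: "payoff \<Gamma> f v < payoff \<Gamma> f' v" if "v \<in> S" for v
      using \<pi>'(2) \<pi>'_eq that by blast
    have SN: "S \<subseteq> ?N" using S by blast
    obtain v0 where v0: "v0 \<in> S" using S by blast
    \<comment> \<open>The component of \<open>v0\<close> in the subgraph induced by
      \<open>S\<close>: the nodes reachable from \<open>v0\<close> along the line without leaving
      \<open>S\<close>.\<close>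
    define I where "I = {w \<in> ?N. \<forall>z\<in>?N. between pos v0 z w \<longrightarrow> z \<in> S}"
    have I_S: "I \<subseteq> S" by (auto simp: I_def between_def)
    have v0_I: "v0 \<in> I"
      using v0 SN inj_onD[OF inj_pos, of v0] by (force simp: I_def between_def)
    have f'_nonneg: "0 \<le> f' P" for P
      using f' unfolding feasible_def by (metis order_refl)
    have f'_demand: "f' (the_path \<Gamma> x y) \<le> demand \<Gamma> {x, y}" if "{x, y} \<in> commodities \<Gamma>" for x y
      using f' that commodity_flow_eq[OF that] unfolding feasible_def by metis
    \<comment> \<open>A path used by the deviation stays in \<open>S\<close>, so it joins only nodes
      of the same component: what lies between \<open>v0\<close> and \<open>y\<close> lies between
      \<open>v0\<close> and \<open>x\<close> or on the path from \<open>x\<close> to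
      \<open>y\<close>.\<close>
    have f'_I: "y \<in> I" if "x \<in> I" "pair_flow \<Gamma> f' x y \<noteq> 0" for x y
    proof -
      have xy: "{x, y} \<in> commodities \<Gamma>" "f' (the_path \<Gamma> x y) \<noteq> 0"
        using that by (auto simp: pair_flow_def split: if_splits)
      then have "z \<in> S" if "z \<in> ?N" "between pos x z y" for z
        using f'_S[OF xy(2)] commodity_nodes[OF xy(1)] that by (auto simp: the_path_nodes)
      moreover have "between pos v0 z x \<or> between pos x z y" if "between pos v0 z y" for z
        using that by (auto simp: between_def)
      ultimately show ?thesis
        using \<open>x \<in> I\<close> commodity_nodes[OF xy(1)] by (auto simp: I_def)
    qed
    \<comment> \<open>By \<open>f'_I\<close> this cut keeps the whole payoff of every node of
      \<open>I\<close>, while no load increases.\<close>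
    define g' where "g' x y = (if x \<in> I \<and> y \<in> I then pair_flow \<Gamma> f' x y else 0)" for x y
    have g'_le: "g' x y \<le> pair_flow \<Gamma> f' x y" for x y
      using f'_nonneg by (simp add: g'_def pair_flow_def)
    have "line_deviation ?N I pos T (pair_flow \<Gamma> f) g' (pair_demand \<Gamma>) (cap \<Gamma>)"
    proof
      show "T y \<le> max (T x) (T z)"
        if "x \<in> ?N" "y \<in> ?N" "z \<in> ?N" "pos x \<le> pos y" "pos y \<le> pos z" for x y z
        using ord that by (simp add: ordered_def between_def)
      show "0 \<le> pair_flow \<Gamma> f x y" for x y using f_nonneg by (simp add: pair_flow_def)
      show "g' x y = g' y x" for x y by (simp add: g'_def pair_flow_commute[of _ _ x])
      show "0 \<le> g' x y" for x y using f'_nonneg by (simp add: g'_def pair_flow_def)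
      show "g' x y \<le> pair_demand \<Gamma> x y" for x y
      proof -
        have "pair_flow \<Gamma> f' x y \<le> pair_demand \<Gamma> x y"
          using f'_demand by (simp add: pair_flow_def pair_demand_def)
        then show ?thesis using g'_le[of x y] by linarith
      qed
      show "load ?N pos g' u \<le> cap \<Gamma> u" if "u \<in> ?N" for u
      proof -
        have "load ?N pos g' u \<le> load ?N pos (pair_flow \<Gamma> f') u"
          unfolding load_def by (intro sum_mono g'_le)
        also have "\<dots> \<le> cap \<Gamma> u"
          using f' that unfolding path_load_eq[OF that, symmetric] feasible_def by blast
        finally show ?thesis .
      qed
      show "g' x y = 0" if "x \<notin> I" for x y using that by (simp add: g'_def)
      show "y \<in> I" if "x \<in> I" "z \<in> I" "y \<in> ?N" "pos x \<le> pos y" "pos y \<le> pos z" for x y z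
      proof -
        have "between pos v0 w x \<or> between pos v0 w z" if "between pos v0 w y" for w
          using that \<open>pos x \<le> pos y\<close> \<open>pos y \<le> pos z\<close> by (auto simp: between_def)
        then show ?thesis using that unfolding I_def by blast
      qed
      show "\<exists>u. blocker ?N pos T (cap \<Gamma>) (pair_flow \<Gamma> f) x y u"
        if "x \<in> ?N" "y \<in> ?N" "pair_flow \<Gamma> f x y < pair_demand \<Gamma> x y" for x y
      proof -
        have xy: "{x, y} \<in> commodities \<Gamma>" "f (the_path \<Gamma> x y) \<noteq> demand \<Gamma> {x, y}"
          using that by (auto simp: pair_flow_def pair_demand_def split: if_splits)
        then obtain u where u: "u \<in> ?N" "between pos x u y" "C u = 0"
          and zero: "\<And>x' y'. \<lbrakk>{x', y'} \<in> commodities \<Gamma>; between pos x' u y'; later pos T x' y' x y\<rbrakk> \<Longrightarrow>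
             f (the_path \<Gamma> x' y') = 0"
          using inv' by blast
        \<comment> \<open>Together with \<open>C u = 0\<close> this says that the final load of
          \<open>u\<close> equals its capacity, as \<open>blocker\<close> demands.\<close>
        have "C u = cap \<Gamma> u - load ?N pos (pair_flow \<Gamma> f) u"
          using inv' u(1) unfolding path_load_eq[OF u(1), symmetric] by blast
        then show ?thesis
          using u zero by (intro exI[of _ u]) (auto simp: blocker_def pair_flow_def)
      qed
      show "(\<Sum>y\<in>?N. pair_flow \<Gamma> f v y) < (\<Sum>y\<in>?N. g' v y)" if "v \<in> I" for v
      proof -
        have "g' v y = pair_flow \<Gamma> f' v y" for y
          using f'_I[OF that, of y] that by (auto simp: g'_def)
        then show ?thesis using gain[of v] that I_S by (auto simp: payoff_eq)
      qed
      show "inj_on T ?N" using ord by (simp add: ordered_def)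
      show "I \<subseteq> ?N" by (auto simp: I_def)
      show "I \<noteq> {}" using v0_I by blast
    qed (fact finite_nodes inj_pos pair_flow_commute pair_demand_commute)+
    then show False by (rule line_deviation.no_deviation)
  qed
  ultimately show ?thesis by (simp add: core_def)
qed

end

theorem theorem1:
  fixes \<Gamma> :: "'v mcf_game" and r :: 'v and f :: "'v path \<Rightarrow> real"
  assumes "mcf_game \<Gamma>"
    and "supply_is_path \<Gamma>"
    and "r \<in> nodes \<Gamma>"
    and "incorporate_returns \<Gamma> r f"
  shows "payoff \<Gamma> f \<in> core \<Gamma>"
proof -
  obtain pos :: "'v \<Rightarrow> int" where "inj_on pos (nodes \<Gamma>)"
    and "\<And>u v. {u, v} \<in> supply_edges \<Gamma> \<Longrightarrow> \<bar>pos u - pos v\<bar> = 1"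
    and "\<And>u v. u \<in> nodes \<Gamma> \<Longrightarrow> v \<in> nodes \<Gamma> \<Longrightarrow> \<exists>P. paths \<Gamma> u v = {P} \<and>
       path_nodes P = {w \<in> nodes \<Gamma>. between pos u w v} \<and> card (path_edges P) = nat \<bar>pos u - pos v\<bar>"
    using supply_path_coordinates[OF assms(2)] by blast
  then interpret path_game \<Gamma> pos
    using assms(1) by unfold_locales auto
  show ?thesis by (rule returned_flow_in_core[OF assms(3,4)])
qed

end
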